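(* Let $G$ be a connected finite graph, and let $\sigma$ and $\sigma^*$ be an acyclic cycle signature and an acyclic cut signature of $G$, respectively. Given a spanning tree $T$ of $G$, let $\mathcal{O}(T)$ be the orientation of $G$ in which each edge $e \notin T$ is oriented according to its orientation in $\sigma(C(T,e))$ and each edge $e \in T$ is oriented according to its orientation in $\sigma^*(C^*(T,e))$. Then the map $T \mapsto [\mathcal{O}(T)]$ is a bijection between the set $\mathcal{T}(G)$ of spanning trees of $G$ and the set $\mathcal{G}(G)$ of cycle-cocycle equivalence classes of orientations of $G$.
   Context: Let $\mathcal{C}(G)$ be the set of simple cycles of $G$ and $\mathcal{C}^*(G)$ the set of bonds (minimal nonempty cuts) of $G$, each regarded as a set of edges. Each simple cycle has two orientations (as a directed cycle), and each bond has two orientations (all edges directed from one side of the cut to the other). Fix a reference orientation of every edge; then a directed cycle or directed bond is identified with the vector in $\mathbb{Z}^{E(G)}$ with entry $1$ at edges used in agreement with the reference orientation, $-1$ at edges used opposite to it, and $0$ at edges not in it. A cycle signature $\sigma$ is a choice, for each $C\in\mathcal{C}(G)$, of an orientation $\sigma(C)$ of $C$; a cut signature $\sigma^*$ is a choice, for each $C\in\mathcal{C}^*(G)$, of an orientation $\sigma^*(C)$ of $C$. The signature $\sigma$ is acyclic if whenever $a_C\ge 0$ are real numbers with $\sum_{C\in\mathcal{C}(G)} a_C\,\sigma(C)=0$, then $a_C=0$ for all $C$; similarly $\sigma^*$ is acyclic if whenever $a_C\ge 0$ with $\sum_{C\in\mathcal{C}^*(G)} a_C\,\sigma^*(C)=0$,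 then $a_C=0$ for all $C$. For a spanning tree $T$ (viewed as a set of edges) and $e\notin T$, $C(T,e)$ is the unique simple cycle contained in $T\cup\{e\}$ (the fundamental cycle). For $e\in T$, $C^*(T,e)$ is the unique bond contained in $(E(G)\setminus T)\cup\{e\}$ (the fundamental cut). An orientation of $G$ is a choice of direction for every edge. Two orientations are cycle-cocycle equivalent if they are related by the equivalence relation generated by reversing all edges of a directed simple cycle of the orientation and reversing all edges of a directed cut (bond) of the orientation. $\mathcal{G}(G)$ is the set of equivalence classes and $[\mathcal{O}]$ denotes the class of $\mathcal{O}$. *)

theory Defs
  imports Complex_Main "Graph_Theory.Graph_Theory"
begin

text \<open>
  A finite graph (loops and parallel edges allowed) together with a reference orientation of its
  edges is a \<^locale>\<open>fin_digraph\<close>: edges are arcs, directed from tail to head by the reference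
  orientation. Everything below treats \<open>G\<close> as an undirected graph; the arc directions only fix the
  signs. In particular the library's \<^const>\<open>Digraph_Component.connected\<close> is weak connectedness, whereas the library's
  \<^const>\<open>forest\<close> and \<^const>\<open>spanning_tree\<close> only exclude directed cycles and are not used.
  Vectors in \<open>\<int>\<^sup>E\<close> are functions into the integers vanishing outside the edge set.
\<close>

definition supp :: "('b \<Rightarrow> int) \<Rightarrow> 'b set" where
  "supp x = {e. x e \<noteq> 0}"


subsection \<open>Cycles\<close>

text \<open>
  The digraph in which every edge \<open>e\<close> can be traversed both ways, as \<open>(e, True)\<close> along its reference
  orientation and as \<open>(e, False)\<close> against it. This also gives a loop two directions.
\<close>

definition traversals :: "('a, 'b) pre_digraph \<Rightarrow> ('a, 'b \<times> bool) pre_digraph" where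
  "traversals G = \<lparr>verts = verts G, arcs = arcs G \<times> UNIV,
     tail = (\<lambda>(e, d). if d then tail G e else head G e),
     head = (\<lambda>(e, d). if d then head G e else tail G e)\<rparr>"

definition walk_vector :: "('b \<times> bool) list \<Rightarrow> 'b \<Rightarrow> int" where
  "walk_vector p e = (if (e, True) \<in> set p then 1 else if (e, False) \<in> set p then - 1 else 0)"

text \<open>
  The library's \<^const>\<open>pre_digraph.cycle\<close> asks for distinct vertices; distinctness of the edges has to
  be added to rule out going back and forth along a single edge.
\<close>

definition directed_cycles :: "('a, 'b) pre_digraph \<Rightarrow> ('b \<Rightarrow> int) set" where
  "directed_cycles G =
     {walk_vector p | p. pre_digraph.cycle (traversals G) p \<and> distinct (map fst p)}"

definition simple_cycles :: "('a, 'b) pre_digraph \<Rightarrow> 'b set set" where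
  "simple_cycles G = supp ` directed_cycles G"


subsection \<open>Bonds\<close>

definition cut :: "('a, 'b) pre_digraph \<Rightarrow> 'a set \<Rightarrow> 'b set" where
  "cut G S = {e \<in> arcs G. (tail G e \<in> S) \<noteq> (head G e \<in> S)}"

definition bonds :: "('a, 'b) pre_digraph \<Rightarrow> 'b set set" where
  "bonds G = {B. (\<exists>S \<subseteq> verts G. B = cut G S) \<and> B \<noteq> {} \<and>
     (\<forall>S \<subseteq> verts G. cut G S \<noteq> {} \<longrightarrow> cut G S \<subseteq> B \<longrightarrow> cut G S = B)}"

text \<open>All edges of the cut directed from \<open>S\<close> to its complement:\<close>

definition cut_vector :: "('a, 'b) pre_digraph \<Rightarrow> 'a set \<Rightarrow> 'b \<Rightarrow> int" where
  "cut_vector G S e =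
     (if e \<in> cut G S then if tail G e \<in> S then 1 else - 1 else 0)"

definition directed_bonds :: "('a, 'b) pre_digraph \<Rightarrow> ('b \<Rightarrow> int) set" where
  "directed_bonds G = {cut_vector G S | S. S \<subseteq> verts G \<and> cut G S \<in> bonds G}"


subsection \<open>Acyclic signatures\<close>

definition cycle_signature ::
    "('a, 'b) pre_digraph \<Rightarrow> ('b set \<Rightarrow> 'b \<Rightarrow> int) \<Rightarrow> bool" where
  "cycle_signature G \<sigma> \<longleftrightarrow>
     (\<forall>C \<in> simple_cycles G. \<sigma> C \<in> directed_cycles G \<and> supp (\<sigma> C) = C)"

definition cut_signature ::
    "('a, 'b) pre_digraph \<Rightarrow> ('b set \<Rightarrow> 'b \<Rightarrow> int) \<Rightarrow> bool" where
  "cut_signature G \<sigma> \<longleftrightarrow>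
     (\<forall>C \<in> bonds G. \<sigma> C \<in> directed_bonds G \<and> supp (\<sigma> C) = C)"

definition acyclic_cycle_signature ::
    "('a, 'b) pre_digraph \<Rightarrow> ('b set \<Rightarrow> 'b \<Rightarrow> int) \<Rightarrow> bool" where
  "acyclic_cycle_signature G \<sigma> \<longleftrightarrow> cycle_signature G \<sigma> \<and>
     (\<forall>a :: 'b set \<Rightarrow> real.
        (\<forall>C \<in> simple_cycles G. a C \<ge> 0) \<longrightarrow>
        (\<forall>e \<in> arcs G. (\<Sum>C \<in> simple_cycles G. a C * of_int (\<sigma> C e)) = 0) \<longrightarrow>
        (\<forall>C \<in> simple_cycles G. a C = 0))"

definition acyclic_cut_signature ::
    "('a, 'b) pre_digraph \<Rightarrow> ('b set \<Rightarrow> 'b \<Rightarrow> int) \<Rightarrow> bool" where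
  "acyclic_cut_signature G \<sigma> \<longleftrightarrow> cut_signature G \<sigma> \<and>
     (\<forall>a :: 'b set \<Rightarrow> real.
        (\<forall>C \<in> bonds G. a C \<ge> 0) \<longrightarrow>
        (\<forall>e \<in> arcs G. (\<Sum>C \<in> bonds G. a C * of_int (\<sigma> C e)) = 0) \<longrightarrow>
        (\<forall>C \<in> bonds G. a C = 0))"


subsection \<open>Spanning trees\<close>

definition spanning_trees :: "('a, 'b) pre_digraph \<Rightarrow> 'b set set" where
  "spanning_trees G = {T. T \<subseteq> arcs G \<and> Digraph_Component.connected (G\<lparr>arcs := T\<rparr>) \<and>
     (\<forall>C \<in> simple_cycles G. \<not> C \<subseteq> T)}"

definition fund_cycle :: "('a, 'b) pre_digraph \<Rightarrow> 'b set \<Rightarrow> 'b \<Rightarrow> 'b set" where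
  "fund_cycle G T e = (THE C. C \<in> simple_cycles G \<and> C \<subseteq> T \<union> {e})"

definition fund_cut :: "('a, 'b) pre_digraph \<Rightarrow> 'b set \<Rightarrow> 'b \<Rightarrow> 'b set" where
  "fund_cut G T e = (THE C. C \<in> bonds G \<and> C \<subseteq> (arcs G - T) \<union> {e})"


subsection \<open>Orientations and cycle-cocycle equivalence\<close>

text \<open>
  An orientation is a sign for every edge, \<open>1\<close> meaning agreement with the reference orientation;
  the value \<open>0\<close> outside the edge set makes the representation unique.
\<close>

definition orientations :: "('a, 'b) pre_digraph \<Rightarrow> ('b \<Rightarrow> int) set" where
  "orientations G = {X. (\<forall>e \<in> arcs G. X e \<in> {1, - 1}) \<and> (\<forall>e. e \<notin> arcs G \<longrightarrow> X e = 0)}"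

text \<open>One reversal of a directed cycle or directed bond \<open>x\<close> that is contained in the orientation:\<close>

definition reversal :: "('a, 'b) pre_digraph \<Rightarrow> ('b \<Rightarrow> int) \<Rightarrow> ('b \<Rightarrow> int) \<Rightarrow> bool" where
  "reversal G X Y \<longleftrightarrow> (\<exists>x \<in> directed_cycles G \<union> directed_bonds G.
     (\<forall>e \<in> supp x. X e = x e) \<and> Y = (\<lambda>e. if e \<in> supp x then - X e else X e))"

definition cycle_cocycle_equiv ::
    "('a, 'b) pre_digraph \<Rightarrow> (('b \<Rightarrow> int) \<times> ('b \<Rightarrow> int)) set" where
  "cycle_cocycle_equiv G =
     {(X, Y). X \<in> orientations G \<and> Y \<in> orientations G \<and> equivclp (reversal G) X Y}"

definition cycle_cocycle_classes :: "('a, 'b) pre_digraph \<Rightarrow> ('b \<Rightarrow> int) set set" where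
  "cycle_cocycle_classes G = orientations G // cycle_cocycle_equiv G"

definition tree_orientation :: "('a, 'b) pre_digraph \<Rightarrow> ('b set \<Rightarrow> 'b \<Rightarrow> int) \<Rightarrow>
    ('b set \<Rightarrow> 'b \<Rightarrow> int) \<Rightarrow> 'b set \<Rightarrow> 'b \<Rightarrow> int" where
  "tree_orientation G \<sigma> \<sigma>' T e =
     (if e \<in> T then \<sigma>' (fund_cut G T e) e
      else if e \<in> arcs G then \<sigma> (fund_cycle G T e) e
      else 0)"

end

theory Submission
  imports Defs "HOL-Library.Multiset"
begin

text \<open>
  The directed cycles and directed bonds of a graph are the signed circuits and cocircuits of an
  oriented regular matroid: \<open>{0, 1, -1}\<close>-vectors, every circuit orthogonal to every cocircuit, linked
  by Minty's painting property (a prescribed direction of an edge lies either on an admissible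
  circuit or on a cocircuit that blocks it). These properties are invariant under exchanging circuits
  and cocircuits. The locale \<open>regular_matroid\<close> collects them; the combinatorial part of the proof
  lives there, and each half of it is proved once and then transported by duality.

  By a theorem of the alternative (\<open>gordan\<close>), a signature \<open>\<sigma>\<close> is acyclic iff some linear functional
  \<open>w\<close> is positive on all chosen circuits; likewise \<open>w'\<close> for the cuts. Call an orientation compatible if
  \<open>w\<close> is positive on each of its directed cycles and \<open>w'\<close> on each of its directed bonds. The theorem
  is then the conjunction of two statements: compatible orientations represent the reversal classes,
  and \<open>T \<mapsto> \<O>(T)\<close> is a bijection from spanning trees to compatible orientations.

  Representatives: reversing a directed bond on which \<open>w'\<close> is negative increases \<open>w'\<close>, and
  reversing directed cycles does not change the set of directed bonds; so maximizing \<open>w'\<close> and then \<open>w\<close>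
  over a class yields a compatible orientation (\<open>compatible_exists\<close>). For uniqueness, the edges that
  lie on directed bonds, and hence those on directed cycles, are the same throughout a class. Two
  equivalent orientations therefore differ by twice \<open>z + b\<close> with \<open>z\<close> a cycle vector and \<open>b\<close> a cut vector
  of disjoint supports. A nonzero \<open>z\<close> would contain a cycle directed in one orientation and
  oppositely directed in the other, on which \<open>w\<close> would have both signs (\<open>compatible_unique\<close>).

  Trees: a vector \<open>z\<close> of the cycle space is the combination of fundamental cycles with coefficients
  \<open>\<plusminus>z e\<close>, \<open>e \<notin> T\<close>. Hence \<open>w\<close> is positive on a nonzero \<open>z\<close> whose signs outside \<open>T\<close> agree with
  \<open>\<O>(T)\<close> (\<open>positive_on_basis_cone\<close>). This makes \<open>\<O>(T)\<close> compatible, and together with the painting property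
  it makes \<open>T \<mapsto> \<O>(T)\<close> injective. For surjectivity, compatibility of \<open>X\<close> makes both
  programs of a dual pair of linear programs feasible. Complementary optimal solutions are vectors \<open>p\<close> and \<open>q\<close> with
  disjoint supports and the signs of \<open>X\<close>, where \<open>p\<close> agrees with \<open>w\<close> on cycles and \<open>q\<close> agrees with
  \<open>w'\<close> on cuts. As \<open>w\<close> vanishes on no cycle and \<open>w'\<close> on no bond, the support of \<open>q\<close> is a spanning
  tree \<open>T\<close>, and evaluating \<open>p\<close> and \<open>q\<close> on its fundamental cycles and cuts shows \<open>\<O>(T) = X\<close>
  (\<open>compatible_is_basis_orientation\<close>).
\<close>

section \<open>Theorems of the alternative\<close>

definition dot :: "'b set \<Rightarrow> ('b \<Rightarrow> real) \<Rightarrow> ('b \<Rightarrow> real) \<Rightarrow> real" where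
  "dot E u v = (\<Sum>e\<in>E. u e * v e)"

abbreviation real_vec :: "('b \<Rightarrow> int) \<Rightarrow> 'b \<Rightarrow> real" where
  "real_vec x \<equiv> (\<lambda>e. real_of_int (x e))"

lemma dot_commute: "dot E u v = dot E v u"
  by (simp add: dot_def mult.commute)

lemma dot_diff_right: "dot E u (\<lambda>e. v e - v' e) = dot E u v - dot E u v'"
  by (simp add: dot_def algebra_simps sum_subtractf)

lemma dot_add_right: "dot E u (\<lambda>e. v e + v' e) = dot E u v + dot E u v'"
  by (simp add: dot_def algebra_simps sum.distrib)

lemma dot_scale_right: "dot E u (\<lambda>e. c * v e) = c * dot E u v"
  by (simp add: dot_def sum_distrib_left algebra_simps)

lemma dot_minus_right: "dot E u (\<lambda>e. - v e) = - dot E u v"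
  by (simp add: dot_def sum_negf)

lemma dot_diff_left: "dot E (\<lambda>e. v e - v' e) u = dot E v u - dot E v' u"
  by (simp add: dot_def algebra_simps sum_subtractf)

lemma dot_add_left: "dot E (\<lambda>e. v e + v' e) u = dot E v u + dot E v' u"
  by (simp add: dot_def algebra_simps sum.distrib)

lemma dot_scale_left: "dot E (\<lambda>e. c * v e) u = c * dot E v u"
  by (simp add: dot_def sum_distrib_left algebra_simps)

lemma dot_sum_right: "dot E u (\<lambda>f. \<Sum>i\<in>I. c i * v i f) = (\<Sum>i\<in>I. c i * dot E u (v i))"
proof -
  have "dot E u (\<lambda>f. \<Sum>i\<in>I. c i * v i f) = (\<Sum>f\<in>E. \<Sum>i\<in>I. c i * (u f * v i f))"
    by (simp add: dot_def sum_distrib_left algebra_simps)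
  also have "\<dots> = (\<Sum>i\<in>I. c i * dot E u (v i))"
    by (subst sum.swap) (simp add: dot_def sum_distrib_left)
  finally show ?thesis .
qed

lemmas dot_linear = dot_diff_right dot_add_right dot_scale_right dot_minus_right
  dot_diff_left dot_add_left dot_scale_left

text \<open>
  Farkas' lemma, by induction on the set of constraints. If constraint \<open>j\<close> is needed, some \<open>x0\<close>
  satisfies all other constraints but not the conclusion, and subtracting multiples of \<open>x0\<close> moves
  every point to the hyperplane \<open>\<alpha> j x = 0\<close>, where the induction hypothesis applies. The domain \<open>V\<close>
  is a set that is closed under linear combinations only as far as the functionals can see; so it
  may consist of tuples of functions, which carry no vector space structure.
\<close>

lemma farkas:
  fixes \<alpha> :: "'i \<Rightarrow> 'v \<Rightarrow> real" and \<gamma> :: "'v \<Rightarrow> real"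
  assumes "finite I"
    and "\<And>x y c. x \<in> V \<Longrightarrow> y \<in> V \<Longrightarrow>
      \<exists>v\<in>V. \<gamma> v = \<gamma> x - c * \<gamma> y \<and> (\<forall>i\<in>I. \<alpha> i v = \<alpha> i x - c * \<alpha> i y)"
    and "\<And>x. x \<in> V \<Longrightarrow> \<forall>i\<in>I. \<alpha> i x \<le> 0 \<Longrightarrow> \<gamma> x \<le> 0"
  shows "\<exists>l. (\<forall>i\<in>I. 0 \<le> l i) \<and> (\<forall>x\<in>V. \<gamma> x = (\<Sum>i\<in>I. l i * \<alpha> i x))"
  using assms
proof (induction I arbitrary: V rule: finite_induct)
  case empty
  have "\<gamma> x = 0" if x: "x \<in> V" for x
  proof -
    obtain v where "v \<in> V" "\<gamma> v = \<gamma> x - 2 * \<gamma> x"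
      using empty(1)[OF x x] by blast
    with empty(2)[of v] empty(2)[OF x] show ?thesis by simp
  qed
  then show ?case by simp
next
  case (insert j I)
  note closed = insert.prems(1) and valid = insert.prems(2)
  show ?case
  proof (cases "\<forall>x\<in>V. (\<forall>i\<in>I. \<alpha> i x \<le> 0) \<longrightarrow> \<gamma> x \<le> 0")
    case True
    have "\<exists>l. (\<forall>i\<in>I. 0 \<le> l i) \<and> (\<forall>x\<in>V. \<gamma> x = (\<Sum>i\<in>I. l i * \<alpha> i x))"
    proof (rule insert.IH)
      fix x y c assume "x \<in> V" "y \<in> V"
      from closed[OF this, of c]
      show "\<exists>v\<in>V. \<gamma> v = \<gamma> x - c * \<gamma> y \<and> (\<forall>i\<in>I. \<alpha> i v = \<alpha> i x - c * \<alpha> i y)" by blast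
    qed (use True in blast)
    then obtain l where l: "\<forall>i\<in>I. 0 \<le> l i" "\<forall>x\<in>V. \<gamma> x = (\<Sum>i\<in>I. l i * \<alpha> i x)" by blast
    have "(\<Sum>i\<in>I. (l(j := 0)) i * \<alpha> i x) = (\<Sum>i\<in>I. l i * \<alpha> i x)" for x
      using insert.hyps by (intro sum.cong) auto
    with l insert.hyps show ?thesis
      by (intro exI[of _ "l(j := 0)"]) auto
  next
    case False
    then obtain x0 where x0: "x0 \<in> V" "\<forall>i\<in>I. \<alpha> i x0 \<le> 0" "\<gamma> x0 > 0" by force
    have pos: "\<alpha> j x0 > 0"
      using valid[OF x0(1)] x0 by force
    have "\<exists>l. (\<forall>i\<in>I. 0 \<le> l i) \<and> (\<forall>x\<in>{x\<in>V. \<alpha> j x = 0}. \<gamma> x = (\<Sum>i\<in>I. l i * \<alpha> i x))"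
    proof (rule insert.IH)
      fix x y c assume xy: "x \<in> {x\<in>V. \<alpha> j x = 0}" "y \<in> {x\<in>V. \<alpha> j x = 0}"
      with closed[of x y c]
      show "\<exists>v\<in>{x\<in>V. \<alpha> j x = 0}.
          \<gamma> v = \<gamma> x - c * \<gamma> y \<and> (\<forall>i\<in>I. \<alpha> i v = \<alpha> i x - c * \<alpha> i y)"
        by auto
    qed (use valid in auto)
    then obtain l where l: "\<forall>i\<in>I. 0 \<le> l i"
      "\<And>x. x \<in> V \<Longrightarrow> \<alpha> j x = 0 \<Longrightarrow> \<gamma> x = (\<Sum>i\<in>I. l i * \<alpha> i x)" by blast
    \<comment> \<open>The multiplier of constraint \<open>j\<close> that makes the identity hold at \<open>x0\<close> as well.\<close>
    define m where "m = (\<gamma> x0 - (\<Sum>i\<in>I. l i * \<alpha> i x0)) / \<alpha> j x0"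
    have "(\<Sum>i\<in>I. l i * \<alpha> i x0) \<le> 0"
      using l(1) x0(2) by (intro sum_nonpos) (simp add: mult_nonneg_nonpos)
    then have m: "m \<ge> 0"
      using x0(3) pos by (simp add: m_def)
    have "\<gamma> x = m * \<alpha> j x + (\<Sum>i\<in>I. l i * \<alpha> i x)" if x: "x \<in> V" for x
    proof -
      define c where "c = \<alpha> j x / \<alpha> j x0"
      obtain v where v: "v \<in> V" "\<gamma> v = \<gamma> x - c * \<gamma> x0"
        "\<forall>i\<in>insert j I. \<alpha> i v = \<alpha> i x - c * \<alpha> i x0"
        using closed[OF x x0(1), of c] by blast
      have "\<alpha> j v = 0" using v(3) pos by (simp add: c_def)
      from l(2)[OF v(1) this] v(2,3)
      have "\<gamma> x = c * \<gamma> x0 + (\<Sum>i\<in>I. l i * (\<alpha> i x - c * \<alpha> i x0))" by simp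
      also have "\<dots> = c * (\<gamma> x0 - (\<Sum>i\<in>I. l i * \<alpha> i x0)) + (\<Sum>i\<in>I. l i * \<alpha> i x)"
        by (simp add: algebra_simps sum_subtractf sum_distrib_left)
      also have "c * (\<gamma> x0 - (\<Sum>i\<in>I. l i * \<alpha> i x0)) = m * \<alpha> j x"
        by (simp add: c_def m_def)
      finally show ?thesis .
    qed
    moreover have "(\<Sum>i\<in>I. (l(j := m)) i * \<alpha> i x) = (\<Sum>i\<in>I. l i * \<alpha> i x)" for x
      using insert.hyps by (intro sum.cong) auto
    ultimately show ?thesis
      using l(1) m insert.hyps by (intro exI[of _ "l(j := m)"]) auto
  qed
qed

text \<open>
  Gordan's theorem: Farkas' lemma for pairs \<open>(w, t)\<close> with the constraints \<open>t \<le> dot E w (v i)\<close> and the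
  conclusion \<open>t \<le> 0\<close>. Its multipliers would be a convex combination of the \<open>v i\<close> equal to zero.
\<close>

lemma gordan:
  fixes v :: "'i \<Rightarrow> 'b \<Rightarrow> real"
  assumes "finite I" "finite E"
    and acyclic: "\<And>a. \<forall>i\<in>I. 0 \<le> a i \<Longrightarrow> \<forall>e\<in>E. (\<Sum>i\<in>I. a i * v i e) = 0 \<Longrightarrow> \<forall>i\<in>I. a i = 0"
  shows "\<exists>w. \<forall>i\<in>I. dot E w (v i) > 0"
proof (rule ccontr)
  assume none: "\<not> ?thesis"
  have "\<exists>l. (\<forall>i\<in>I. 0 \<le> l i) \<and>
    (\<forall>x\<in>UNIV. snd x = (\<Sum>i\<in>I. l i * (snd x - dot E (fst x) (v i))))"
  proof (rule farkas[OF assms(1)])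
    fix x y :: "('b \<Rightarrow> real) \<times> real" and c :: real
    show "\<exists>u\<in>UNIV. snd u = snd x - c * snd y \<and> (\<forall>i\<in>I. snd u - dot E (fst u) (v i) =
        snd x - dot E (fst x) (v i) - c * (snd y - dot E (fst y) (v i)))"
      by (rule bexI[of _ "(\<lambda>e. fst x e - c * fst y e, snd x - c * snd y)"])
        (auto simp: dot_linear algebra_simps)
  next
    fix x :: "('b \<Rightarrow> real) \<times> real"
    assume "\<forall>i\<in>I. snd x - dot E (fst x) (v i) \<le> 0"
    then have "\<forall>i\<in>I. dot E (fst x) (v i) \<ge> snd x" by simp
    with none show "snd x \<le> 0" by (meson less_le_trans not_le)
  qed
  then obtain l where l: "\<forall>i\<in>I. 0 \<le> l i"
    "\<And>w t. t = (\<Sum>i\<in>I. l i * (t - dot E w (v i)))" by auto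
  have one: "(\<Sum>i\<in>I. l i) = 1"
    using l(2)[of 1 "\<lambda>_. 0"] by (simp add: dot_def)
  have "(\<Sum>i\<in>I. l i * v i e) = 0" if "e \<in> E" for e
  proof -
    have "dot E (\<lambda>f. if f = e then 1 else 0) (v i) = v i e" for i
      using assms(2) that by (simp add: dot_def if_distrib[of "\<lambda>x. x * _"] cong: if_cong)
    with l(2)[of 0 "\<lambda>f. if f = e then 1 else 0"] show ?thesis
      by (simp add: sum_negf)
  qed
  with acyclic[OF l(1)] have "\<forall>i\<in>I. l i = 0" by blast
  with one show False by simp
qed

section \<open>Signed circuits and cocircuits\<close>

definition conforms :: "('b \<Rightarrow> int) \<Rightarrow> ('b \<Rightarrow> int) \<Rightarrow> bool" where
  "conforms X x \<longleftrightarrow> (\<forall>e\<in>supp x. X e = x e)"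

text \<open>
  For the cocircuits \<open>\<D>\<close> of a graph this is the real cycle space, and for the circuits the cut space.
\<close>

definition perp :: "'b set \<Rightarrow> ('b \<Rightarrow> int) set \<Rightarrow> ('b \<Rightarrow> real) set" where
  "perp E \<D> = {z. \<forall>D\<in>\<D>. dot E z (real_vec D) = 0}"

definition orients :: "'b set \<Rightarrow> ('b \<Rightarrow> int) set" where
  "orients E = {X. (\<forall>e\<in>E. X e \<in> {1, - 1}) \<and> (\<forall>e. e \<notin> E \<longrightarrow> X e = 0)}"

definition fundamental :: "('b \<Rightarrow> int) set \<Rightarrow> 'b set \<Rightarrow> 'b \<Rightarrow> 'b set" where
  "fundamental \<C> T e = (THE S. S \<in> supp ` \<C> \<and> S \<subseteq> T \<union> {e})"

text \<open>
  The acyclic signatures together with a functional that certifies acyclicity.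
\<close>

definition positive_signature ::
    "'b set \<Rightarrow> ('b \<Rightarrow> int) set \<Rightarrow> ('b set \<Rightarrow> 'b \<Rightarrow> int) \<Rightarrow> ('b \<Rightarrow> real) \<Rightarrow> bool" where
  "positive_signature E \<C> \<sigma> w \<longleftrightarrow>
     (\<forall>S\<in>supp ` \<C>. \<sigma> S \<in> \<C> \<and> supp (\<sigma> S) = S \<and> dot E w (real_vec (\<sigma> S)) > 0)"

definition signature_compatible ::
    "'b set \<Rightarrow> ('b \<Rightarrow> int) set \<Rightarrow> ('b \<Rightarrow> real) \<Rightarrow> ('b \<Rightarrow> int) \<Rightarrow> bool" where
  "signature_compatible E \<C> w X \<longleftrightarrow> (\<forall>C\<in>\<C>. conforms X C \<longrightarrow> dot E w (real_vec C) > 0)"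

lemma positive_signature_of_acyclic:
  assumes fin: "finite E" and supp: "\<And>x. x \<in> \<C> \<Longrightarrow> supp x \<subseteq> E"
    and sig: "\<forall>C\<in>supp ` \<C>. \<sigma> C \<in> \<C> \<and> supp (\<sigma> C) = C"
    and acyclic: "\<And>a :: 'b set \<Rightarrow> real. \<forall>C\<in>supp ` \<C>. a C \<ge> 0 \<Longrightarrow>
      \<forall>e\<in>E. (\<Sum>C\<in>supp ` \<C>. a C * of_int (\<sigma> C e)) = 0 \<Longrightarrow> \<forall>C\<in>supp ` \<C>. a C = 0"
  obtains w where "positive_signature E \<C> \<sigma> w"
proof -
  have "supp ` \<C> \<subseteq> Pow E" using supp by blast
  then have "finite (supp ` \<C>)" by (rule finite_subset) (simp add: fin)
  then have "\<exists>w. \<forall>C\<in>supp ` \<C>. dot E w (real_vec (\<sigma> C)) > 0"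
    by (rule gordan[OF _ fin]) (rule acyclic)
  then obtain w where "\<forall>C\<in>supp ` \<C>. dot E w (real_vec (\<sigma> C)) > 0" ..
  with sig that show thesis by (auto simp: positive_signature_def)
qed

text \<open>
  The signed circuits \<open>\<C>\<close> and cocircuits \<open>\<D>\<close> of an oriented regular matroid. Orthogonality in the
  arithmetic sense, not merely as a sign pattern, is where regularity enters. In the painting axiom,
  \<open>F f s\<close> permits edge \<open>f\<close> to be used in direction \<open>s\<close>: an edge may be permitted in both directions,
  in one, or in none, and \<open>e\<close> is permitted in one only. The second alternative is a cocircuit none
  of whose edges may be used against it. Replacing \<open>F f s\<close> by \<open>\<not> F f (- s)\<close> exchanges the two
  alternatives, so the axioms are self-dual.
\<close>

locale regular_matroid =
  fixes E :: "'b set" and \<C> \<D> :: "('b \<Rightarrow> int) set"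
  assumes finite_E: "finite E"
    and signs: "x \<in> \<C> \<union> \<D> \<Longrightarrow> x e \<in> {1, - 1, 0}"
    and supp_subset: "x \<in> \<C> \<union> \<D> \<Longrightarrow> supp x \<subseteq> E"
    and supp_nonempty: "x \<in> \<C> \<union> \<D> \<Longrightarrow> supp x \<noteq> {}"
    and circuit_neg: "C \<in> \<C> \<Longrightarrow> (\<lambda>e. - C e) \<in> \<C>"
    and cocircuit_neg: "D \<in> \<D> \<Longrightarrow> (\<lambda>e. - D e) \<in> \<D>"
    and circuit_minimal: "C \<in> \<C> \<Longrightarrow> C' \<in> \<C> \<Longrightarrow> supp C' \<subseteq> supp C \<Longrightarrow> supp C' = supp C"
    and cocircuit_minimal: "D \<in> \<D> \<Longrightarrow> D' \<in> \<D> \<Longrightarrow> supp D' \<subseteq> supp D \<Longrightarrow> supp D' = supp D"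
    and orthogonal: "C \<in> \<C> \<Longrightarrow> D \<in> \<D> \<Longrightarrow> dot E (real_vec C) (real_vec D) = 0"
    and painting: "e \<in> E \<Longrightarrow> s \<in> {1, - 1} \<Longrightarrow> F e s \<Longrightarrow> \<not> F e (- s) \<Longrightarrow>
      (\<exists>C\<in>\<C>. C e = s \<and> (\<forall>f\<in>supp C. F f (C f))) \<or>
      (\<exists>D\<in>\<D>. D e = s \<and> (\<forall>f\<in>supp D. \<not> F f (- D f)))"
begin

lemma dual: "regular_matroid E \<D> \<C>"
proof (unfold_locales)
  fix e s and F :: "'b \<Rightarrow> int \<Rightarrow> bool"
  assume "e \<in> E" "s \<in> {1, - 1}" "F e s" "\<not> F e (- s)"
  then show "(\<exists>C\<in>\<D>. C e = s \<and> (\<forall>f\<in>supp C. F f (C f))) \<or>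
      (\<exists>D\<in>\<C>. D e = s \<and> (\<forall>f\<in>supp D. \<not> F f (- D f)))"
    using painting[of e s "\<lambda>f s. \<not> F f (- s)"] by auto
next
  fix C D assume "C \<in> \<D>" "D \<in> \<C>"
  then show "dot E (real_vec C) (real_vec D) = 0"
    using orthogonal dot_commute by metis
next
  fix C C' assume "C \<in> \<D>" "C' \<in> \<D>" "supp C' \<subseteq> supp C"
  then show "supp C' = supp C" by (rule cocircuit_minimal)
next
  fix C C' assume "C \<in> \<C>" "C' \<in> \<C>" "supp C' \<subseteq> supp C"
  then show "supp C' = supp C" by (rule circuit_minimal)
qed (use finite_E signs supp_subset supp_nonempty circuit_neg cocircuit_neg in blast)+

lemma circuit_in_perp: "C \<in> \<C> \<Longrightarrow> real_vec C \<in> perp E \<D>"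
  using orthogonal by (simp add: perp_def)

text \<open>
  Permit exactly the directions in which \<open>z\<close> is nonzero. A blocking cocircuit would have a positive
  inner product with \<open>z\<close>.
\<close>

lemma conformal_circuit:
  assumes z: "z \<in> perp E \<D>" and e: "e \<in> E" "z e \<noteq> 0"
  obtains C where "C \<in> \<C>" "C e \<noteq> 0" "\<And>f. f \<in> supp C \<Longrightarrow> real_of_int (C f) * z f > 0"
proof -
  define s :: int where "s = (if z e > 0 then 1 else - 1)"
  have s: "s \<in> {1, - 1}" "real_of_int s * z e > 0" "\<not> real_of_int (- s) * z e > 0"
    using e(2) by (auto simp: s_def)
  have "(\<exists>C\<in>\<C>. C e = s \<and> (\<forall>f\<in>supp C. real_of_int (C f) * z f > 0)) \<or>
      (\<exists>D\<in>\<D>. D e = s \<and> (\<forall>f\<in>supp D. \<not> real_of_int (- D f) * z f > 0))"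
    using painting[of e s "\<lambda>f s. real_of_int s * z f > 0"] s e by blast
  moreover have False if D: "D \<in> \<D>" "D e = s" "\<forall>f\<in>supp D. \<not> real_of_int (- D f) * z f > 0" for D
  proof -
    have nonneg: "z f * real_of_int (D f) \<ge> 0" for f
      using D(3) by (cases "D f = 0") (auto simp: supp_def mult.commute)
    have "dot E z (real_vec D) > 0"
      unfolding dot_def
      using finite_E e(1) s(2) D(2) nonneg
      by (intro sum_pos2[where i = e]) (auto simp: mult.commute)
    with z D(1) show False by (simp add: perp_def)
  qed
  ultimately obtain C where C: "C \<in> \<C>" "C e = s" "\<forall>f\<in>supp C. real_of_int (C f) * z f > 0" by blast
  then show thesis using that[of C] s(1) by auto
qed

text \<open>
  Subtracting \<open>\<plusminus>C'\<close> from \<open>C\<close> so that \<open>e\<close> cancels leaves a vector of the circuit space. If it were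
  nonzero, its support would contain a circuit avoiding \<open>e\<close>. This yields both the uniqueness of
  fundamental circuits and the fact that a circuit has only two orientations.
\<close>

lemma circuit_unique:
  assumes C: "C \<in> \<C>" "C' \<in> \<C>" and e: "e \<in> supp C" "e \<in> supp C'"
    and no: "\<And>B. B \<in> \<C> \<Longrightarrow> \<not> supp B \<subseteq> supp C \<union> supp C' - {e}"
  shows "C' = C \<or> C' = (\<lambda>f. - C f)"
proof -
  define s where "s = C e * C' e"
  have ce: "C e \<in> {1, -1}" "C' e \<in> {1, -1}"
    using signs[of C e] signs[of C' e] C e by (auto simp: supp_def)
  then have s: "s \<in> {1, -1}" by (auto simp: s_def)
  define z where "z f = real_of_int (C f) - real_of_int s * real_of_int (C' f)" for f
  have z: "z \<in> perp E \<D>"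
    using orthogonal[OF C(1)] orthogonal[OF C(2)] by (simp add: perp_def z_def[abs_def] dot_linear)
  have "z f = 0" if f: "f \<in> E" for f
  proof (rule ccontr)
    assume "z f \<noteq> 0"
    then obtain B where B: "B \<in> \<C>" "\<And>f. f \<in> supp B \<Longrightarrow> real_of_int (B f) * z f > 0"
      using conformal_circuit[OF z f] by metis
    have "z e = 0" using ce by (auto simp: z_def s_def)
    then have "supp B \<subseteq> supp C \<union> supp C' - {e}"
      using B(2) by (force simp: z_def supp_def)
    with no B(1) show False by blast
  qed
  moreover have "C f = 0 \<and> C' f = 0" if "f \<notin> E" for f
    using supp_subset[of C] supp_subset[of C'] C that by (auto simp: supp_def)
  ultimately have eq: "real_of_int (C f) = real_of_int s * real_of_int (C' f)" for f
    by (cases "f \<in> E") (auto simp: z_def)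
  have "C f = s * C' f" for f
    using eq[of f] by (metis of_int_eq_iff of_int_mult)
  with s show ?thesis by auto
qed

lemma same_support:
  assumes C: "C \<in> \<C>" "C' \<in> \<C>" and eq: "supp C' = supp C"
  shows "C' = C \<or> C' = (\<lambda>f. - C f)"
proof -
  obtain e where e: "e \<in> supp C" using supp_nonempty[of C] C by auto
  have "\<not> supp B \<subseteq> supp C \<union> supp C' - {e}" if "B \<in> \<C>" for B
    using circuit_minimal[OF C(1) that] e eq by auto
  with circuit_unique[OF C e] e eq show ?thesis by auto
qed

text \<open>
  Every vector orthogonal to all cocircuits is a nonnegative combination of circuits with the same
  signs: subtract the largest multiple of such a circuit that preserves the signs, and induct on the
  support.
\<close>

lemma conformal_cone:
  assumes "z \<in> perp E \<D>"
    and "\<And>C. C \<in> \<C> \<Longrightarrow> (\<And>f. f \<in> supp C \<Longrightarrow> real_of_int (C f) * z f > 0) \<Longrightarrow>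
      dot E w (real_vec C) \<ge> 0"
  shows "dot E w z \<ge> 0"
  using assms
proof (induction "card {e\<in>E. z e \<noteq> 0}" arbitrary: z rule: less_induct)
  case less
  note z = less.prems(1) and w = less.prems(2)
  show ?case
  proof (cases "\<forall>e\<in>E. z e = 0")
    case True
    then show ?thesis by (simp add: dot_def)
  next
    case False
    then obtain e where e: "e \<in> E" "z e \<noteq> 0" by blast
    then obtain C where C: "C \<in> \<C>" "\<And>f. f \<in> supp C \<Longrightarrow> real_of_int (C f) * z f > 0"
      using conformal_circuit[OF z] by metis
    have supp: "supp C \<subseteq> E" "supp C \<noteq> {}" "finite (supp C)"
      using supp_subset[of C] supp_nonempty[of C] C(1) finite_E by (auto intro: finite_subset)
    \<comment> \<open>The largest multiple of \<open>C\<close> that can be subtracted without changing a sign.\<close>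
    define t where "t = Min ((\<lambda>f. \<bar>z f\<bar>) ` supp C)"
    have "t \<in> (\<lambda>f. \<bar>z f\<bar>) ` supp C"
      unfolding t_def using supp by (intro Min_in) auto
    then obtain g where g: "g \<in> supp C" "t = \<bar>z g\<bar>" by blast
    have t_le: "t \<le> \<bar>z f\<bar>" if "f \<in> supp C" for f
      unfolding t_def using supp that by (intro Min_le) auto
    have abs: "real_of_int (C f) * \<bar>z f\<bar> = z f" if "f \<in> supp C" for f
      using signs[of C f] C(1) C(2)[OF that] that by (auto simp: supp_def)
    have t: "t > 0" using g C(2)[OF g(1)] by auto
    define z' where "z' f = z f - t * real_of_int (C f)" for f
    have z'_C: "z' f = real_of_int (C f) * (\<bar>z f\<bar> - t)" if "f \<in> supp C" for f
      using abs[OF that] by (simp add: z'_def algebra_simps)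
    have z'_off: "z' f = z f" if "f \<notin> supp C" for f
      using that by (simp add: z'_def supp_def)
    have sub: "{f\<in>E. z' f \<noteq> 0} \<subset> {f\<in>E. z f \<noteq> 0}"
    proof
      show "{f\<in>E. z' f \<noteq> 0} \<subseteq> {f\<in>E. z f \<noteq> 0}"
      proof
        fix f assume "f \<in> {f\<in>E. z' f \<noteq> 0}"
        then show "f \<in> {f\<in>E. z f \<noteq> 0}"
          using C(2)[of f] z'_off[of f] by (cases "f \<in> supp C") auto
      qed
      have "g \<in> {f\<in>E. z f \<noteq> 0}" "g \<notin> {f\<in>E. z' f \<noteq> 0}"
        using g supp t z'_C[OF g(1)] by auto
      then show "{f\<in>E. z' f \<noteq> 0} \<noteq> {f\<in>E. z f \<noteq> 0}" by blast
    qed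
    have "dot E w z' \<ge> 0"
    proof (rule less.hyps)
      show "card {e\<in>E. z' e \<noteq> 0} < card {e\<in>E. z e \<noteq> 0}"
        using sub finite_E by (intro psubset_card_mono) auto
      show "z' \<in> perp E \<D>"
        using z orthogonal[OF C(1)] by (simp add: perp_def z'_def[abs_def] dot_linear)
      fix B assume B: "B \<in> \<C>" "\<And>f. f \<in> supp B \<Longrightarrow> real_of_int (B f) * z' f > 0"
      show "dot E w (real_vec B) \<ge> 0"
      proof (rule w[OF B(1)])
        fix f assume f: "f \<in> supp B"
        show "real_of_int (B f) * z f > 0"
        proof (cases "f \<in> supp C")
          case True
          have "real_of_int (B f) * (real_of_int (C f) * (\<bar>z f\<bar> - t)) > 0"
            using B(2)[OF f] z'_C[OF True] by simp
          then have "real_of_int (B f) * real_of_int (C f) > 0"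
            using t_le[OF True] by (simp add: mult.assoc[symmetric] zero_less_mult_iff)
          moreover have "\<bar>z f\<bar> > 0" using C(2)[OF True] by auto
          ultimately have "real_of_int (B f) * real_of_int (C f) * \<bar>z f\<bar> > 0"
            by (rule mult_pos_pos)
          then show ?thesis using abs[OF True] by (simp add: mult.assoc)
        qed (use B(2)[OF f] z'_off in simp)
      qed
    qed
    moreover have "dot E w (real_vec C) \<ge> 0" using w[OF C] .
    moreover have "dot E w z = dot E w z' + t * dot E w (real_vec C)"
      by (simp add: z'_def[abs_def] dot_linear)
    ultimately show ?thesis using t by simp
  qed
qed

lemma perps_orthogonal:
  assumes z: "z \<in> perp E \<D>" and b: "b \<in> perp E \<C>"
  shows "dot E b z = 0"
proof -
  have "dot E b z \<ge> 0"
    by (rule conformal_cone[OF z]) (use b in \<open>auto simp: perp_def\<close>)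
  moreover have "dot E (\<lambda>e. -1 * b e) z \<ge> 0"
    by (rule conformal_cone[OF z]) (use b in \<open>auto simp only: perp_def dot_scale_left\<close>)
  ultimately show ?thesis by (simp only: dot_scale_left)
qed

end

section \<open>Orientations defined by bases\<close>

context regular_matroid
begin

text \<open>
  Compatibility controls \<open>w\<close> on simple directed cycles; linear programming needs it on all real
  circulations with the signs of \<open>X\<close>.
\<close>

lemma compatible_cone:
  assumes X: "X \<in> orients E" "signature_compatible E \<C> w X"
    and z: "z \<in> perp E \<D>" "\<And>e. e \<in> E \<Longrightarrow> real_of_int (X e) * z e \<ge> 0"
  shows "dot E w z \<ge> 0"
proof (rule conformal_cone[OF z(1)])
  fix C assume C: "C \<in> \<C>" "\<And>f. f \<in> supp C \<Longrightarrow> real_of_int (C f) * z f > 0"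
  have "X f = C f" if f: "f \<in> supp C" for f
  proof -
    have "f \<in> E" using f C(1) supp_subset by blast
    then have "X f \<in> {1, - 1}" "real_of_int (X f) * z f \<ge> 0" using X z(2) by (auto simp: orients_def)
    moreover have "C f \<in> {1, - 1}" using signs[of C f] C(1) f by (auto simp: supp_def)
    ultimately show ?thesis using C(2)[OF f] by auto
  qed
  with X(2) C(1) show "dot E w (real_vec C) \<ge> 0"
    by (auto simp: signature_compatible_def conforms_def intro: less_imp_le)
qed

text \<open>
  Independent and spanning, the latter in the form that every cocircuit meets \<open>T\<close>; this makes the
  notion self-dual under \<open>T \<mapsto> E - T\<close>.
\<close>

definition basis :: "'b set \<Rightarrow> bool" where
  "basis T \<longleftrightarrow> T \<subseteq> E \<and> (\<forall>C\<in>\<C>. \<not> supp C \<subseteq> T) \<and> (\<forall>D\<in>\<D>. \<not> supp D \<subseteq> E - T)"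

definition basis_orientation ::
    "('b set \<Rightarrow> 'b \<Rightarrow> int) \<Rightarrow> ('b set \<Rightarrow> 'b \<Rightarrow> int) \<Rightarrow> 'b set \<Rightarrow> 'b \<Rightarrow> int" where
  "basis_orientation \<sigma> \<sigma>' T e =
     (if e \<in> T then \<sigma>' (fundamental \<D> (E - T) e) e
      else if e \<in> E then \<sigma> (fundamental \<C> T e) e
      else 0)"

lemma basis_dual: "basis T \<Longrightarrow> regular_matroid.basis E \<D> \<C> (E - T)"
  by (auto simp: basis_def regular_matroid.basis_def[OF dual] double_diff)

lemma basis_orientation_dual:
  "T \<subseteq> E \<Longrightarrow>
    regular_matroid.basis_orientation E \<D> \<C> \<sigma>' \<sigma> (E - T) = basis_orientation \<sigma> \<sigma>' T"
  by (auto simp: fun_eq_iff basis_orientation_def regular_matroid.basis_orientation_def[OF dual]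
      double_diff)

lemma fundamental_unique:
  assumes T: "basis T" and e: "e \<in> E - T"
    and C: "C \<in> \<C>" "supp C \<subseteq> T \<union> {e}"
  shows "fundamental \<C> T e = supp C"
  unfolding fundamental_def
proof (rule the_equality)
  show "supp C \<in> supp ` \<C> \<and> supp C \<subseteq> T \<union> {e}" using C by blast
next
  fix S assume "S \<in> supp ` \<C> \<and> S \<subseteq> T \<union> {e}"
  then obtain C' where C': "C' \<in> \<C>" "S = supp C'" "supp C' \<subseteq> T \<union> {e}" by blast
  have no: "\<not> supp B \<subseteq> T" if "B \<in> \<C>" for B
    using T that by (auto simp: basis_def)
  have "C' = C \<or> C' = (\<lambda>f. - C f)"
    by (rule circuit_unique[where e = e]) (use C C' no in blast)+
  then show "S = supp C" using C'(2) by (auto simp: supp_def)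
qed

text \<open>
  Permit \<open>T\<close> in both directions and \<open>e\<close> in one: a blocking cocircuit would avoid \<open>T\<close>.
\<close>

lemma fundamental_circuit:
  assumes T: "basis T" and e: "e \<in> E - T"
  shows "fundamental \<C> T e \<in> supp ` \<C>" "fundamental \<C> T e \<subseteq> T \<union> {e}" "e \<in> fundamental \<C> T e"
proof -
  have no: "\<not> supp B \<subseteq> T" if "B \<in> \<C>" for B
    using T that by (auto simp: basis_def)
  have "(\<exists>C\<in>\<C>. C e = 1 \<and> (\<forall>f\<in>supp C. f \<in> T \<or> f = e \<and> C f = 1)) \<or>
      (\<exists>D\<in>\<D>. D e = 1 \<and> (\<forall>f\<in>supp D. \<not> (f \<in> T \<or> f = e \<and> - D f = 1)))"
    using painting[of e 1 "\<lambda>f s. f \<in> T \<or> f = e \<and> s = 1"] e by auto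
  moreover have False if "D \<in> \<D>" "\<forall>f\<in>supp D. f \<notin> T" for D
    using that T supp_subset[of D] unfolding basis_def by blast
  ultimately obtain C where C: "C \<in> \<C>" "supp C \<subseteq> T \<union> {e}" by blast
  have "e \<in> supp C" using no[OF C(1)] C(2) by blast
  with C fundamental_unique[OF T e C]
  show "fundamental \<C> T e \<in> supp ` \<C>" "fundamental \<C> T e \<subseteq> T \<union> {e}" "e \<in> fundamental \<C> T e"
    by auto
qed

context
  fixes T \<sigma> w
  assumes T: "basis T" and \<sigma>: "positive_signature E \<C> \<sigma> w"
begin

lemma fundamental_signed:
  assumes e: "e \<in> E - T"
  shows "\<sigma> (fundamental \<C> T e) \<in> \<C>" "\<sigma> (fundamental \<C> T e) e \<in> {1, - 1}"
    "f \<notin> T \<Longrightarrow> f \<noteq> e \<Longrightarrow> \<sigma> (fundamental \<C> T e) f = 0"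
    "dot E w (real_vec (\<sigma> (fundamental \<C> T e))) > 0"
proof -
  let ?C = "\<sigma> (fundamental \<C> T e)"
  have C: "?C \<in> \<C>" "supp ?C = fundamental \<C> T e" "dot E w (real_vec ?C) > 0"
    using \<sigma> fundamental_circuit[OF T e] by (auto simp: positive_signature_def)
  then show "?C \<in> \<C>" "dot E w (real_vec ?C) > 0" by auto
  show "?C e \<in> {1, - 1}"
    using signs[of ?C e] C fundamental_circuit(3)[OF T e] by (auto simp: supp_def)
  show "?C f = 0" if "f \<notin> T" "f \<noteq> e"
    using that C(2) fundamental_circuit(2)[OF T e] by (auto simp: supp_def)
qed

text \<open>
  The fundamental circuits of a basis form a basis of the circuit space in which \<open>z\<close> has
  coordinates \<open>z e\<close>, \<open>e \<in> E - T\<close>, up to the signs in \<open>\<sigma>\<close>; and \<open>w\<close> is positive on each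
  \<open>\<sigma>\<close>-oriented fundamental circuit.
\<close>

lemma positive_on_basis_cone:
  assumes z: "z \<in> perp E \<D>" "e \<in> E" "z e \<noteq> 0"
    and pos: "\<And>e. e \<in> E - T \<Longrightarrow> z e * real_of_int (\<sigma> (fundamental \<C> T e) e) \<ge> 0"
  shows "dot E w z > 0"
proof -
  define C where "C e = \<sigma> (fundamental \<C> T e)" for e
  note C = fundamental_signed[folded C_def]
  have fin: "finite (E - T)" using finite_E by simp
  define c where "c e = z e * real_of_int (C e e)" for e
  \<comment> \<open>A nonzero vector of the circuit space is nonzero off \<open>T\<close>, as \<open>T\<close> contains no circuit.\<close>
  have off_T: "\<exists>f\<in>E - T. y f \<noteq> 0" if y: "y \<in> perp E \<D>" "g \<in> E" "y g \<noteq> 0" for y g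
  proof (rule ccontr)
    assume zero: "\<not> ?thesis"
    obtain B where B: "B \<in> \<C>" "\<And>f. f \<in> supp B \<Longrightarrow> real_of_int (B f) * y f > 0"
      using conformal_circuit[OF y] by metis
    have "supp B \<subseteq> T"
    proof
      fix f assume f: "f \<in> supp B"
      then have "f \<in> E" "y f \<noteq> 0" using supp_subset[of B] B(1) B(2)[OF f] by auto
      then show "f \<in> T" using zero by blast
    qed
    then show False using T B(1) by (auto simp: basis_def)
  qed
  define y where "y = (\<lambda>f. z f - (\<Sum>e\<in>E - T. c e * real_of_int (C e f)))"
  have "y \<in> perp E \<D>"
  proof -
    have "dot E (\<lambda>f. \<Sum>e\<in>E - T. c e * real_of_int (C e f)) (real_vec D) = 0" if D: "D \<in> \<D>" for D
      using orthogonal[OF C(1) D]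
      by (subst dot_commute) (simp add: dot_sum_right dot_commute[of E "real_vec D"])
    then show ?thesis using z(1) by (simp add: perp_def y_def dot_linear)
  qed
  moreover have "y f = 0" if f: "f \<in> E - T" for f
  proof -
    have "(\<Sum>e\<in>E - T. c e * real_of_int (C e f)) = (\<Sum>e\<in>{f}. c e * real_of_int (C e f))"
      using f fin C(3) by (intro sum.mono_neutral_right) auto
    also have "\<dots> = z f" using C(2)[OF f] by (auto simp: c_def)
    finally show ?thesis by (simp add: y_def)
  qed
  ultimately have "\<forall>g\<in>E. y g = 0" using off_T by blast
  then have "dot E w z = dot E w (\<lambda>f. \<Sum>e\<in>E - T. c e * real_of_int (C e f))"
    unfolding dot_def by (intro sum.cong) (auto simp: y_def)
  also have "\<dots> = (\<Sum>e\<in>E - T. c e * dot E w (real_vec (C e)))"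
    by (rule dot_sum_right)
  also have "\<dots> > 0"
  proof -
    obtain f where f: "f \<in> E - T" "z f \<noteq> 0" using off_T[OF z] by blast
    have nonneg: "c e \<ge> 0" if "e \<in> E - T" for e
      using pos[OF that] by (simp add: c_def C_def)
    have "c f > 0" using nonneg[OF f(1)] f(2) C(2)[OF f(1)] by (auto simp: c_def)
    then show ?thesis
      using fin f(1) nonneg C(4)
      by (intro sum_pos2[of _ f]) (auto intro: mult_nonneg_nonneg less_imp_le)
  qed
  finally show ?thesis .
qed

lemma basis_orientation_compatible_circuits: "signature_compatible E \<C> w (basis_orientation \<sigma> \<sigma>' T)"
  unfolding signature_compatible_def
proof (intro ballI impI)
  fix C assume C: "C \<in> \<C>" "conforms (basis_orientation \<sigma> \<sigma>' T) C"
  obtain e where "e \<in> supp C" using supp_nonempty[of C] C(1) by auto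
  then have e: "e \<in> E" "real_vec C e \<noteq> 0" using supp_subset[of C] C(1) by (auto simp: supp_def)
  show "dot E w (real_vec C) > 0"
  proof (rule positive_on_basis_cone[OF circuit_in_perp[OF C(1)] e])
    fix f assume f: "f \<in> E - T"
    show "real_vec C f * real_of_int (\<sigma> (fundamental \<C> T f) f) \<ge> 0"
    proof (cases "f \<in> supp C")
      case True
      then have "C f = \<sigma> (fundamental \<C> T f) f"
        using C(2) f by (auto simp: conforms_def basis_orientation_def)
      then show ?thesis by simp
    qed (simp add: supp_def)
  qed
qed

end

lemma basis_orientation_compatible:
  assumes T: "basis T"
    and \<sigma>: "positive_signature E \<C> \<sigma> w" and \<sigma>': "positive_signature E \<D> \<sigma>' w'"
  shows "basis_orientation \<sigma> \<sigma>' T \<in> orients E"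
    "signature_compatible E \<C> w (basis_orientation \<sigma> \<sigma>' T)"
    "signature_compatible E \<D> w' (basis_orientation \<sigma> \<sigma>' T)"
proof -
  have TE: "T \<subseteq> E" using T by (simp add: basis_def)
  show "signature_compatible E \<C> w (basis_orientation \<sigma> \<sigma>' T)"
    by (rule basis_orientation_compatible_circuits[OF T \<sigma>])
  show "signature_compatible E \<D> w' (basis_orientation \<sigma> \<sigma>' T)"
    using regular_matroid.basis_orientation_compatible_circuits[OF dual basis_dual[OF T] \<sigma>', of \<sigma>]
    by (simp add: basis_orientation_dual[OF TE])
  have "\<sigma>' (fundamental \<D> (E - T) e) e \<in> {1, - 1}" if "e \<in> T" for e
    using regular_matroid.fundamental_signed(2)[OF dual basis_dual[OF T] \<sigma>', of e] that TE by auto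
  then show "basis_orientation \<sigma> \<sigma>' T \<in> orients E"
    using fundamental_signed(2)[OF T \<sigma>] TE by (auto simp: orients_def basis_orientation_def)
qed

text \<open>
  Suppose two bases give the same orientation \<open>X\<close>. Permit both directions on \<open>T\<^sub>1 \<inter> T\<^sub>2\<close>, the direction
  of \<open>X\<close> on \<open>T\<^sub>2 - T\<^sub>1\<close>, the opposite one on \<open>T\<^sub>1 - T\<^sub>2\<close>, and none elsewhere. A permitted circuit agrees
  with \<open>X\<close> outside \<open>T\<^sub>1\<close>, and its negative agrees with \<open>X\<close> outside \<open>T\<^sub>2\<close>, so \<open>w\<close> is positive on both.
  A blocking cocircuit is impossible by the same argument for \<open>w'\<close>.
\<close>

lemma basis_orientation_inj:
  assumes T: "basis T\<^sub>1" "basis T\<^sub>2"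
    and \<sigma>: "positive_signature E \<C> \<sigma> w" and \<sigma>': "positive_signature E \<D> \<sigma>' w'"
    and eq: "basis_orientation \<sigma> \<sigma>' T\<^sub>1 = basis_orientation \<sigma> \<sigma>' T\<^sub>2"
  shows "T\<^sub>1 = T\<^sub>2"
proof (rule ccontr)
  assume neq: "T\<^sub>1 \<noteq> T\<^sub>2"
  define X where "X = basis_orientation \<sigma> \<sigma>' T\<^sub>1"
  have X: "X f \<in> {1, - 1}" if "f \<in> E" for f
    using basis_orientation_compatible(1)[OF T(1) \<sigma> \<sigma>'] that by (auto simp: orients_def X_def)
  have TE: "T\<^sub>1 \<subseteq> E" "T\<^sub>2 \<subseteq> E" using T by (auto simp: basis_def)
  have X_off: "\<sigma> (fundamental \<C> T\<^sub>1 f) f = X f" if "f \<in> E - T\<^sub>1" for f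
    using that by (simp add: X_def basis_orientation_def)
  have X_off': "\<sigma> (fundamental \<C> T\<^sub>2 f) f = X f" if "f \<in> E - T\<^sub>2" for f
    using that by (simp add: X_def eq basis_orientation_def)
  have X_on: "\<sigma>' (fundamental \<D> (E - T\<^sub>1) f) f = X f" if "f \<in> T\<^sub>1" for f
    using that by (simp add: X_def basis_orientation_def)
  have X_on': "\<sigma>' (fundamental \<D> (E - T\<^sub>2) f) f = X f" if "f \<in> T\<^sub>2" for f
    using that by (simp add: X_def eq basis_orientation_def)
  obtain e where e: "e \<in> E" "e \<in> T\<^sub>1 \<longleftrightarrow> e \<notin> T\<^sub>2" using neq TE by blast
  define F where "F f s \<longleftrightarrow> f \<in> T\<^sub>1 \<and> f \<in> T\<^sub>2 \<or> f \<in> T\<^sub>1 - T\<^sub>2 \<and> s = - X f \<or> f \<in> T\<^sub>2 - T\<^sub>1 \<and> s = X f"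
    for f s
  define s where "s = (if e \<in> T\<^sub>1 then - X e else X e)"
  have s: "s \<in> {1, - 1}" "F e s" "\<not> F e (- s)"
    using e X[OF e(1)] by (auto simp: s_def F_def)
  from painting[of e s F, OF e(1) s] show False
  proof (elim disjE bexE conjE)
    fix C assume C: "C \<in> \<C>" "C e = s" "\<forall>f\<in>supp C. F f (C f)"
    have ne: "real_vec C e \<noteq> 0" "real_vec (\<lambda>e. - C e) e \<noteq> 0" using C(2) s by auto
    have "dot E w (real_vec C) > 0"
    proof (rule positive_on_basis_cone[OF T(1) \<sigma> circuit_in_perp[OF C(1)] e(1) ne(1)])
      fix f assume f: "f \<in> E - T\<^sub>1"
      then show "real_vec C f * real_of_int (\<sigma> (fundamental \<C> T\<^sub>1 f) f) \<ge> 0"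
        using C(3) by (cases "f \<in> supp C") (auto simp: X_off F_def supp_def)
    qed
    moreover have "dot E w (real_vec (\<lambda>e. - C e)) > 0"
    proof (rule positive_on_basis_cone
        [OF T(2) \<sigma> circuit_in_perp[OF circuit_neg[OF C(1)]] e(1) ne(2)])
      fix f assume f: "f \<in> E - T\<^sub>2"
      then show "real_vec (\<lambda>e. - C e) f * real_of_int (\<sigma> (fundamental \<C> T\<^sub>2 f) f) \<ge> 0"
        using C(3) by (cases "f \<in> supp C") (auto simp: X_off' F_def supp_def)
    qed
    ultimately show False by (simp add: dot_minus_right)
  next
    fix D assume D: "D \<in> \<D>" "D e = s" "\<forall>f\<in>supp D. \<not> F f (- D f)"
    have ne: "real_vec D e \<noteq> 0" "real_vec (\<lambda>e. - D e) e \<noteq> 0" using D(2) s by auto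
    have D_sign: "D f \<in> {1, - 1}" "X f \<in> {1, - 1}" if "f \<in> supp D" for f
      using signs[of D f] X[of f] supp_subset[of D] D(1) that by (auto simp: supp_def)
    note cone = regular_matroid.positive_on_basis_cone[OF dual basis_dual _ _ e(1), OF _ \<sigma>']
    note in_perp = regular_matroid.circuit_in_perp[OF dual]
    have "dot E w' (real_vec (\<lambda>e. - D e)) > 0"
    proof (rule cone[OF T(1) in_perp[OF cocircuit_neg[OF D(1)]] ne(2)])
      fix f assume "f \<in> E - (E - T\<^sub>1)"
      then have f: "f \<in> T\<^sub>1" by blast
      show "real_vec (\<lambda>e. - D e) f * real_of_int (\<sigma>' (fundamental \<D> (E - T\<^sub>1) f) f) \<ge> 0"
      proof (cases "f \<in> supp D")
        case True
        then show ?thesis using f D_sign[OF True] D(3) by (auto simp: X_on[OF f] F_def)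
      qed (simp add: supp_def)
    qed
    moreover have "dot E w' (real_vec D) > 0"
    proof (rule cone[OF T(2) in_perp[OF D(1)] ne(1)])
      fix f assume "f \<in> E - (E - T\<^sub>2)"
      then have f: "f \<in> T\<^sub>2" by blast
      show "real_vec D f * real_of_int (\<sigma>' (fundamental \<D> (E - T\<^sub>2) f) f) \<ge> 0"
      proof (cases "f \<in> supp D")
        case True
        then show ?thesis using f D_sign[OF True] D(3) by (auto simp: X_on'[OF f] F_def)
      qed (simp add: supp_def)
    qed
    ultimately show False by (simp add: dot_minus_right)
  qed
qed

end

section \<open>Compatible orientations come from bases\<close>

context regular_matroid
begin

text \<open>
  The optimality conditions for a pair of dual linear programs: \<open>p\<close> ranges over the translate of the
  cut space by \<open>w\<close>, \<open>q\<close> over the translate of the cycle space by \<open>w'\<close>, both with the signs of \<open>X\<close>. As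
  \<open>p - w\<close> and \<open>q - w'\<close> are orthogonal, \<open>dot E p q\<close> is an affine function of \<open>(p, q)\<close>, and the
  conditions, including \<open>dot E p q \<le> 0\<close>, are a linear system. Farkas' lemma produces \<open>p\<close> and \<open>q\<close> as
  multipliers; its hypothesis holds because \<open>w\<close> and \<open>w'\<close> are nonnegative on the cycle and cut vectors
  with the signs of \<open>X\<close>.
\<close>

lemma complementary_pair:
  assumes X: "X \<in> orients E" "signature_compatible E \<C> w X" "signature_compatible E \<D> w' X"
  obtains p q where
    "\<And>C. C \<in> \<C> \<Longrightarrow> dot E p (real_vec C) = dot E w (real_vec C)"
    "\<And>D. D \<in> \<D> \<Longrightarrow> dot E q (real_vec D) = dot E w' (real_vec D)"
    "\<And>e. e \<in> E \<Longrightarrow> real_of_int (X e) * p e \<ge> 0"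
    "\<And>e. e \<in> E \<Longrightarrow> real_of_int (X e) * q e \<ge> 0"
    "\<And>e. e \<in> E \<Longrightarrow> p e = 0 \<or> q e = 0"
proof -
  define x where "x e = real_of_int (X e)" for e
  have xx: "x e * x e = 1" if "e \<in> E" for e
    using X(1) that by (auto simp: orients_def x_def)
  define V where "V = {(z, b, t :: real). z \<in> perp E \<D> \<and> b \<in> perp E \<C>}"
  define \<gamma> where "\<gamma> = (\<lambda>(z, b, t). dot E w z + dot E w' b + t * dot E w w')"
  define \<alpha> :: "'b + 'b + unit \<Rightarrow> ('b \<Rightarrow> real) \<times> ('b \<Rightarrow> real) \<times> real \<Rightarrow> real" where
    "\<alpha> = (\<lambda>i (z, b, t). case i of Inl e \<Rightarrow> x e * (z e + t * w' e)
      | Inr (Inl e) \<Rightarrow> x e * (b e + t * w e) | Inr (Inr _) \<Rightarrow> t)"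
  \<comment> \<open>The constraints whose multipliers will be \<open>\<bar>p e\<bar>\<close>, \<open>\<bar>q e\<bar>\<close> and the slack in
    \<open>dot E p q \<le> 0\<close>.\<close>
  define I :: "('b + 'b + unit) set" where "I = E <+> (E <+> {()})"
  have "\<exists>l. (\<forall>i\<in>I. 0 \<le> l i) \<and> (\<forall>v\<in>V. \<gamma> v = (\<Sum>i\<in>I. l i * \<alpha> i v))"
  proof (rule farkas)
    show "finite I" using finite_E by (simp add: I_def)
  next
    fix u v :: "('b \<Rightarrow> real) \<times> ('b \<Rightarrow> real) \<times> real" and c :: real
    assume uv: "u \<in> V" "v \<in> V"
    obtain z b t z' b' t' where [simp]: "u = (z, b, t)" "v = (z', b', t')"
      by (cases u; cases v) auto
    show "\<exists>y\<in>V. \<gamma> y = \<gamma> u - c * \<gamma> v \<and> (\<forall>i\<in>I. \<alpha> i y = \<alpha> i u - c * \<alpha> i v)"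
    proof (rule bexI[of _ "(\<lambda>e. z e - c * z' e, \<lambda>e. b e - c * b' e, t - c * t')"], intro conjI ballI)
      show "(\<lambda>e. z e - c * z' e, \<lambda>e. b e - c * b' e, t - c * t') \<in> V"
        using uv by (simp add: V_def perp_def dot_linear)
    qed (auto simp: \<gamma>_def \<alpha>_def dot_linear algebra_simps split: sum.splits)
  next
    fix v assume v: "v \<in> V" and le: "\<forall>i\<in>I. \<alpha> i v \<le> 0"
    obtain z b t where [simp]: "v = (z, b, t)" by (cases v) auto
    have z: "z \<in> perp E \<D>" and b: "b \<in> perp E \<C>" using v by (auto simp: V_def)
    have zb: "x e * (z e + t * w' e) \<le> 0" "x e * (b e + t * w e) \<le> 0" if "e \<in> E" for e
      using le[rule_format, of "Inl e"] le[rule_format, of "Inr (Inl e)"] that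
      by (auto simp: I_def \<alpha>_def)
    have "Inr (Inr ()) \<in> I" by (auto simp: I_def)
    then have t: "t \<le> 0" using le by (force simp: \<alpha>_def)
    show "\<gamma> v \<le> 0"
    \<comment> \<open>For \<open>t = 0\<close> this is compatibility; for \<open>t < 0\<close> it is weak duality, scaled by \<open>t\<close>.\<close>
    proof (cases "t = 0")
      case True
      have "dot E w (\<lambda>e. - z e) \<ge> 0"
        using X(1,2) z zb(1) by (intro compatible_cone) (auto simp: perp_def dot_scale_left[of E "-1", simplified] True x_def)
      moreover have "dot E w' (\<lambda>e. - b e) \<ge> 0"
        using X(1,3) b zb(2)
        by (intro regular_matroid.compatible_cone[OF dual]) (auto simp: perp_def dot_scale_left[of E "-1", simplified] True x_def)
      ultimately show ?thesis by (simp add: \<gamma>_def True dot_minus_right)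
    next
      case False
      have "0 \<le> dot E (\<lambda>e. z e + t * w' e) (\<lambda>e. b e + t * w e)"
        unfolding dot_def
      proof (rule sum_nonneg)
        fix e assume e: "e \<in> E"
        have "0 \<le> (x e * (z e + t * w' e)) * (x e * (b e + t * w e))"
          using zb[OF e] by (rule mult_nonpos_nonpos)
        also have "\<dots> = (x e * x e) * ((z e + t * w' e) * (b e + t * w e))"
          by (simp only: mult_ac)
        finally show "0 \<le> (z e + t * w' e) * (b e + t * w e)" using xx[OF e] by simp
      qed
      also have "\<dots> = t * \<gamma> v"
        using perps_orthogonal[OF z b]
        by (simp add: \<gamma>_def dot_linear dot_commute[of E z] dot_commute[of E w'] algebra_simps)
      finally show ?thesis using t False by (simp add: zero_le_mult_iff)
    qed
  qed
  then obtain l where l: "\<And>i. i \<in> I \<Longrightarrow> 0 \<le> l i" "\<And>v. v \<in> V \<Longrightarrow> \<gamma> v = (\<Sum>i\<in>I. l i * \<alpha> i v)" by blast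
  define p where "p e = x e * l (Inl e)" for e
  define q where "q e = x e * l (Inr (Inl e))" for e
  define s where "s = l (Inr (Inr ()))"
  have s: "s \<ge> 0" unfolding s_def by (rule l(1)) (auto simp: I_def)
  have xp: "x e * p e \<ge> 0" "x e * q e \<ge> 0" if e: "e \<in> E" for e
  proof -
    have "l (Inl e) \<ge> 0" "l (Inr (Inl e)) \<ge> 0"
      using e by (auto simp: I_def intro!: l(1))
    then show "x e * p e \<ge> 0" "x e * q e \<ge> 0"
      using xx[OF e] by (simp_all add: p_def q_def mult.assoc[symmetric])
  qed
  have key: "dot E w z + dot E w' b + t * dot E w w' =
      dot E p (\<lambda>e. z e + t * w' e) + dot E q (\<lambda>e. b e + t * w e) + s * t"
    if "z \<in> perp E \<D>" "b \<in> perp E \<C>" for z b t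
  proof -
    have "(z, b, t) \<in> V" using that by (simp add: V_def)
    from l(2)[OF this] show ?thesis
      using finite_E
      by (simp add: I_def sum.Plus \<gamma>_def \<alpha>_def dot_def p_def q_def s_def mult_ac)
  qed
  have zero: "(\<lambda>e. 0) \<in> perp E \<A>" for \<A> by (simp add: perp_def dot_def)
  have pz: "dot E p z = dot E w z" if "z \<in> perp E \<D>" for z
    using key[OF that zero, of 0] by (simp add: dot_def)
  have qb: "dot E q b = dot E w' b" if "b \<in> perp E \<C>" for b
    using key[OF zero that, of 0] by (simp add: dot_def)
  have gap: "dot E w w' = dot E p w' + dot E q w + s"
    using key[OF zero zero, of 1] by (simp add: dot_def)
  have pC: "dot E p (real_vec C) = dot E w (real_vec C)" if "C \<in> \<C>" for C
    using pz circuit_in_perp that by blast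
  have qD: "dot E q (real_vec D) = dot E w' (real_vec D)" if "D \<in> \<D>" for D
    using qb regular_matroid.circuit_in_perp[OF dual] that by blast
  have "dot E (\<lambda>e. p e - w e) (\<lambda>e. q e - w' e) = 0"
    by (rule perps_orthogonal) (simp_all add: perp_def dot_linear pC qD)
  then have "dot E p q = - s"
    using gap by (simp add: dot_linear dot_commute[of E q])
  have pq_nonneg: "p e * q e \<ge> 0" if e: "e \<in> E" for e
  proof -
    have "0 \<le> (x e * p e) * (x e * q e)" using xp[OF e] by simp
    also have "\<dots> = (x e * x e) * (p e * q e)" by (simp only: mult_ac)
    finally show ?thesis using xx[OF e] by simp
  qed
  have "(\<Sum>e\<in>E. p e * q e) \<ge> 0"
    using pq_nonneg by (rule sum_nonneg)
  then have "(\<Sum>e\<in>E. p e * q e) = 0"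
    using \<open>dot E p q = - s\<close> s by (simp add: dot_def)
  then have "p e * q e = 0" if "e \<in> E" for e
    using sum_nonneg_eq_0_iff[OF finite_E, of "\<lambda>e. p e * q e"] pq_nonneg that by blast
  then show thesis
    using that[of p q] pC qD xp by (simp add: x_def)
qed

lemma positive_signature_generic:
  assumes "positive_signature E \<C> \<sigma> w" and C: "C \<in> \<C>"
  shows "dot E w (real_vec C) \<noteq> 0"
proof -
  have s: "\<sigma> (supp C) \<in> \<C>" "supp (\<sigma> (supp C)) = supp C" "dot E w (real_vec (\<sigma> (supp C))) > 0"
    using assms by (auto simp: positive_signature_def)
  with same_support[OF C s(1,2)] show ?thesis by (auto simp: dot_minus_right)
qed

lemma compatible_is_basis_orientation:
  assumes \<sigma>: "positive_signature E \<C> \<sigma> w" and \<sigma>': "positive_signature E \<D> \<sigma>' w'"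
    and X: "X \<in> orients E" "signature_compatible E \<C> w X" "signature_compatible E \<D> w' X"
  shows "\<exists>T. basis T \<and> basis_orientation \<sigma> \<sigma>' T = X"
proof -
  obtain p q where
    p: "\<And>C. C \<in> \<C> \<Longrightarrow> dot E p (real_vec C) = dot E w (real_vec C)" and
    q: "\<And>D. D \<in> \<D> \<Longrightarrow> dot E q (real_vec D) = dot E w' (real_vec D)" and
    Xp: "\<And>e. e \<in> E \<Longrightarrow> real_of_int (X e) * p e \<ge> 0" and
    Xq: "\<And>e. e \<in> E \<Longrightarrow> real_of_int (X e) * q e \<ge> 0" and
    pq: "\<And>e. e \<in> E \<Longrightarrow> p e = 0 \<or> q e = 0"
    using complementary_pair[OF X] by metis
  \<comment> \<open>Complementarity and genericity of \<open>w\<close> and \<open>w'\<close> force this support to be a basis.\<close>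
  define T where "T = {e \<in> E. q e \<noteq> 0}"
  have TE: "T \<subseteq> E" by (auto simp: T_def)
  have pT: "p e = 0" if "e \<in> T" for e using that pq by (auto simp: T_def)
  have qT: "q e = 0" if "e \<in> E - T" for e using that by (auto simp: T_def)
  have "\<not> supp C \<subseteq> T" if C: "C \<in> \<C>" for C
  proof
    assume "supp C \<subseteq> T"
    then have "dot E p (real_vec C) = 0"
      using pT by (auto simp: dot_def supp_def intro!: sum.neutral)
    with positive_signature_generic[OF \<sigma> C] p[OF C] show False by simp
  qed
  moreover have "\<not> supp D \<subseteq> E - T" if D: "D \<in> \<D>" for D
  proof
    assume "supp D \<subseteq> E - T"
    then have "dot E q (real_vec D) = 0"
      using qT by (auto simp: dot_def supp_def intro!: sum.neutral)
    with regular_matroid.positive_signature_generic[OF dual \<sigma>' D] q[OF D] show False by simp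
  qed
  ultimately have T: "basis T" using TE by (auto simp: basis_def)
  have "\<sigma> (fundamental \<C> T e) e = X e" if e: "e \<in> E - T" for e
  proof -
    note C = fundamental_signed[OF T \<sigma> e]
    let ?C = "\<sigma> (fundamental \<C> T e)"
    have "dot E p (real_vec ?C) = (\<Sum>f\<in>{e}. p f * real_of_int (?C f))"
      unfolding dot_def using finite_E e pT C(3) by (intro sum.mono_neutral_right) fastforce+
    with C(4) p[OF C(1)] have "p e * real_of_int (?C e) > 0" by simp
    with Xp[of e] C(2) X(1) e show ?thesis
      by (auto simp: orients_def zero_less_mult_iff)
  qed
  moreover have "\<sigma>' (fundamental \<D> (E - T) e) e = X e" if e: "e \<in> T" for e
  proof -
    have e': "e \<in> E - (E - T)" using e TE by blast
    note D = regular_matroid.fundamental_signed[OF dual basis_dual[OF T] \<sigma>' e']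
    let ?D = "\<sigma>' (fundamental \<D> (E - T) e)"
    have "dot E q (real_vec ?D) = (\<Sum>f\<in>{e}. q f * real_of_int (?D f))"
      unfolding dot_def using finite_E e' qT D(3) by (intro sum.mono_neutral_right) fastforce+
    with D(4) q[OF D(1)] have "q e * real_of_int (?D e) > 0" by simp
    moreover have "e \<in> E" using e TE by blast
    ultimately show ?thesis
      using Xq[of e] D(2) X(1) by (auto simp: orients_def zero_less_mult_iff)
  qed
  ultimately have "basis_orientation \<sigma> \<sigma>' T = X"
    using X(1) by (auto simp: fun_eq_iff basis_orientation_def orients_def)
  with T show ?thesis by blast
qed

end

section \<open>Reversal classes\<close>

definition flip :: "('b \<Rightarrow> int) \<Rightarrow> ('b \<Rightarrow> int) \<Rightarrow> 'b \<Rightarrow> int" where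
  "flip X x = (\<lambda>e. if e \<in> supp x then - X e else X e)"

definition flips :: "('b \<Rightarrow> int) set \<Rightarrow> ('b \<Rightarrow> int) \<Rightarrow> ('b \<Rightarrow> int) \<Rightarrow> bool" where
  "flips \<A> X Y \<longleftrightarrow> (\<exists>x\<in>\<A>. conforms X x \<and> Y = flip X x)"

definition conforming_edges :: "('b \<Rightarrow> int) set \<Rightarrow> ('b \<Rightarrow> int) \<Rightarrow> 'b set" where
  "conforming_edges \<A> X = {e. \<exists>x\<in>\<A>. conforms X x \<and> e \<in> supp x}"

lemma flip_eq: "conforms X x \<Longrightarrow> flip X x e = X e - 2 * x e"
  by (auto simp: flip_def conforms_def supp_def)

lemma flip_conforms: "conforms X x \<Longrightarrow> conforms (flip X x) (\<lambda>e. - x e)"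
  by (auto simp: flip_def conforms_def supp_def)

lemma flip_flip: "flip (flip X x) (\<lambda>e. - x e) = X"
  by (auto simp: flip_def supp_def)

lemma flip_orients: "X \<in> orients E \<Longrightarrow> flip X x \<in> orients E"
  by (auto simp: flip_def orients_def)

lemma finite_orients:
  fixes E :: "'b set"
  assumes "finite E"
  shows "finite (orients E)"
proof (rule finite_subset)
  show "orients E \<subseteq> {X. \<forall>e. (e \<in> E \<longrightarrow> X e \<in> {1, - 1}) \<and> (e \<notin> E \<longrightarrow> X e = 0)}"
    by (auto simp: orients_def)
  show "finite {X :: 'b \<Rightarrow> int. \<forall>e. (e \<in> E \<longrightarrow> X e \<in> {1, - 1}) \<and> (e \<notin> E \<longrightarrow> X e = 0)}"
    using assms by (intro finite_set_of_finite_funs) auto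
qed

lemma ex_maximum:
  fixes f :: "'c \<Rightarrow> real"
  assumes "finite K" "K \<noteq> {}"
  obtains y where "y \<in> K" "\<And>x. x \<in> K \<Longrightarrow> f x \<le> f y"
proof -
  have "Max (f ` K) \<in> f ` K" using assms by (intro Max_in) auto
  then obtain y where "y \<in> K" "f y = Max (f ` K)" by auto
  with assms show thesis by (intro that[of y]) auto
qed

context regular_matroid
begin

lemma flips_sym:
  assumes "flips (\<C> \<union> \<D>) X Y" shows "flips (\<C> \<union> \<D>) Y X"
proof -
  obtain x where x: "x \<in> \<C> \<union> \<D>" "conforms X x" "Y = flip X x"
    using assms by (auto simp: flips_def)
  then have "(\<lambda>e. - x e) \<in> \<C> \<union> \<D>" using circuit_neg cocircuit_neg by blast
  with x show ?thesis
    unfolding flips_def by (metis flip_conforms flip_flip)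
qed

text \<open>
  Where both are nonzero they agree with \<open>X\<close>, so a common edge would make the inner product positive.
\<close>

lemma conforming_disjoint:
  assumes "C \<in> \<C>" "conforms X C" "D \<in> \<D>" "conforms X D"
  shows "supp C \<inter> supp D = {}"
proof (rule ccontr)
  assume "supp C \<inter> supp D \<noteq> {}"
  then obtain e where e: "e \<in> supp C" "e \<in> supp D" by blast
  have eq: "C f = D f \<or> C f = 0 \<or> D f = 0" for f
    using assms by (metis (mono_tags) conforms_def mem_Collect_eq supp_def)
  have "dot E (real_vec C) (real_vec D) > 0"
    unfolding dot_def
  proof (rule sum_pos2[OF finite_E])
    show "e \<in> E" using e supp_subset[of C] assms by auto
    show "real_vec C e * real_vec D e > 0" using e eq[of e] by (auto simp: supp_def zero_less_mult_iff)
    show "real_vec C f * real_vec D f \<ge> 0" for f using eq[of f] by auto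
  qed
  with orthogonal[OF assms(1,3)] show False by simp
qed

text \<open>
  Painting with the directions of \<open>X\<close>: each edge lies on a directed circuit or on a directed cocircuit.
\<close>

lemma conforming_edges_partition:
  assumes X: "X \<in> orients E"
  shows "conforming_edges \<D> X = E - conforming_edges \<C> X"
proof (rule set_eqI, rule iffI)
  fix e assume "e \<in> conforming_edges \<D> X"
  then obtain D where D: "D \<in> \<D>" "conforms X D" "e \<in> supp D" by (auto simp: conforming_edges_def)
  then have "e \<notin> conforming_edges \<C> X"
    using conforming_disjoint[of _ X D] by (auto simp: conforming_edges_def)
  with D supp_subset[of D] show "e \<in> E - conforming_edges \<C> X" by auto
next
  fix e assume e: "e \<in> E - conforming_edges \<C> X"
  have Xe: "X f \<in> {1, - 1}" if "f \<in> E" for f using X that by (auto simp: orients_def)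
  have "e \<in> E" "X e \<in> {1, - 1}" "X e = X e" "\<not> - X e = X e" using Xe[of e] e by auto
  from painting[of e "X e" "\<lambda>f s. s = X f", OF this]
  have "(\<exists>C\<in>\<C>. C e = X e \<and> (\<forall>f\<in>supp C. C f = X f)) \<or>
      (\<exists>D\<in>\<D>. D e = X e \<and> (\<forall>f\<in>supp D. \<not> - D f = X f))" .
  moreover have "\<not> (\<exists>C\<in>\<C>. C e = X e \<and> (\<forall>f\<in>supp C. C f = X f))"
  proof
    assume "\<exists>C\<in>\<C>. C e = X e \<and> (\<forall>f\<in>supp C. C f = X f)"
    then obtain C where C: "C \<in> \<C>" "C e = X e" "\<forall>f\<in>supp C. C f = X f" by blast
    have "conforms X C" unfolding conforms_def using C(3) by metis
    moreover have "X e \<noteq> 0" using Xe[of e] e by auto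
    then have "e \<in> supp C" using C(2) by (simp add: supp_def)
    ultimately show False using C(1) e by (auto simp: conforming_edges_def)
  qed
  ultimately obtain D where D: "D \<in> \<D>" "D e = X e" "\<forall>f\<in>supp D. \<not> - D f = X f" by blast
  have "conforms X D"
    unfolding conforms_def
  proof
    fix f assume f: "f \<in> supp D"
    then have "D f \<in> {1, - 1}" "X f \<in> {1, - 1}"
      using signs[of D f] Xe[of f] D(1) supp_subset[of D] by (auto simp: supp_def)
    with D(3) f show "X f = D f" by auto
  qed
  moreover have "e \<in> supp D" using D(2) Xe[of e] e by (auto simp: supp_def)
  ultimately show "e \<in> conforming_edges \<D> X" using D(1) by (auto simp: conforming_edges_def)
qed

lemma circuit_flip_keeps_cocircuits:
  assumes "C \<in> \<C>" "conforms X C" "D \<in> \<D>"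
  shows "conforms (flip X C) D \<longleftrightarrow> conforms X D"
proof -
  have "conforms (flip Y B) D" if B: "B \<in> \<C>" "conforms Y B" and D: "conforms Y D" for Y B
  proof -
    have "supp B \<inter> supp D = {}" using conforming_disjoint[OF B assms(3) D] .
    with D show ?thesis by (auto simp: conforms_def flip_def)
  qed
  from this[of C X] this[of "\<lambda>e. - C e" "flip X C"] show ?thesis
    using assms circuit_neg flip_conforms[of X C] by (auto simp: flip_flip)
qed

text \<open>
  Reversing a directed circuit leaves all directed cocircuits alone, since they are disjoint from it.
  Reversing a directed cocircuit leaves the directed circuits alone, and these determine the other
  edges by complementation.
\<close>

lemma flip_conforming_edges:
  assumes X: "X \<in> orients E" and x: "x \<in> \<C> \<union> \<D>" "conforms X x"
  shows "conforming_edges \<D> (flip X x) = conforming_edges \<D> X"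
proof (cases "x \<in> \<C>")
  case True
  then show ?thesis
    using circuit_flip_keeps_cocircuits[OF True x(2)] by (auto simp: conforming_edges_def)
next
  case False
  then have "x \<in> \<D>" using x by blast
  then have "conforming_edges \<C> (flip X x) = conforming_edges \<C> X"
    using regular_matroid.circuit_flip_keeps_cocircuits[OF dual _ x(2)]
    by (auto simp: conforming_edges_def)
  then show ?thesis
    using X by (simp add: conforming_edges_partition flip_orients)
qed

text \<open>
  All circuits reversed along the way avoid the fixed set of edges on directed cocircuits, and all
  cocircuits reversed stay inside it; so the two parts of the difference have disjoint supports.
\<close>

lemma equivalent_difference:
  assumes "equivclp (flips (\<C> \<union> \<D>)) X Y" and X: "X \<in> orients E"
  shows "Y \<in> orients E \<and> conforming_edges \<D> Y = conforming_edges \<D> X \<and>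
    (\<exists>z\<in>perp E \<D>. \<exists>b\<in>perp E \<C>. (\<forall>e. real_of_int (X e) - real_of_int (Y e) = 2 * (z e + b e)) \<and>
      (\<forall>e. z e = 0 \<or> b e = 0))"
proof -
  let ?K = "conforming_edges \<D> X"
  have "Y \<in> orients E \<and> conforming_edges \<D> Y = ?K \<and>
    (\<exists>z\<in>perp E \<D>. \<exists>b\<in>perp E \<C>. (\<forall>e. real_of_int (X e) - real_of_int (Y e) = 2 * (z e + b e)) \<and>
      (\<forall>e. if e \<in> ?K then z e = 0 else b e = 0))"
    using assms(1)
  proof (induction rule: equivclp_induct)
    case base
    show ?case
      by (intro conjI X refl bexI[of _ "\<lambda>_. 0"]) (auto simp: perp_def dot_def)
  next
    case (step Y Y')
    then obtain z b where Y: "Y \<in> orients E" "conforming_edges \<D> Y = ?K"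
      and zb: "z \<in> perp E \<D>" "b \<in> perp E \<C>"
        "\<And>e. real_of_int (X e) - real_of_int (Y e) = 2 * (z e + b e)"
        "\<And>e. if e \<in> ?K then z e = 0 else b e = 0" by blast
    have "flips (\<C> \<union> \<D>) Y Y'" using step.hyps(2) flips_sym by blast
    then obtain x where x: "x \<in> \<C> \<union> \<D>" "conforms Y x" "Y' = flip Y x" by (auto simp: flips_def)
    have Y': "Y' \<in> orients E" "conforming_edges \<D> Y' = ?K"
      using flip_orients[OF Y(1)] flip_conforming_edges[OF Y(1) x(1,2)] Y(2) x(3) by auto
    have diff: "real_of_int (Y e) - real_of_int (Y' e) = 2 * real_of_int (x e)" for e
      using flip_eq[OF x(2), of e] x(3) by simp
    show ?case
    proof (cases "x \<in> \<C>")
      case True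
      have "e \<notin> ?K" if "x e \<noteq> 0" for e
        using that True x(2) conforming_edges_partition[OF Y(1)] Y(2)
        by (auto simp: conforming_edges_def supp_def)
      then have "\<forall>e. if e \<in> ?K then z e + real_of_int (x e) = 0 else b e = 0"
        using zb(4) by (smt (verit) of_int_0)
      moreover have "(\<lambda>e. z e + real_of_int (x e)) \<in> perp E \<D>"
        using zb(1) circuit_in_perp[OF True] by (simp add: perp_def dot_linear)
      moreover have "real_of_int (X e) - real_of_int (Y' e) = 2 * (z e + real_of_int (x e) + b e)" for e
        using diff[of e] zb(3)[of e] by simp
      ultimately show ?thesis
        using Y' zb(2) by (intro conjI bexI[of _ "\<lambda>e. z e + real_of_int (x e)"] bexI[of _ b]) auto
    next
      case False
      then have D: "x \<in> \<D>" using x(1) by blast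
      have "e \<in> ?K" if "x e \<noteq> 0" for e
        using that D x(2) Y(2)[symmetric] by (auto simp: conforming_edges_def supp_def)
      then have "\<forall>e. if e \<in> ?K then z e = 0 else b e + real_of_int (x e) = 0"
        using zb(4) by (smt (verit) of_int_0)
      moreover have "(\<lambda>e. b e + real_of_int (x e)) \<in> perp E \<C>"
        using zb(2) regular_matroid.circuit_in_perp[OF dual D] by (simp add: perp_def dot_linear)
      moreover have "real_of_int (X e) - real_of_int (Y' e) = 2 * (z e + (b e + real_of_int (x e)))" for e
        using diff[of e] zb(3)[of e] by simp
      ultimately show ?thesis
        using Y' zb(1) by (intro conjI bexI[of _ z] bexI[of _ "\<lambda>e. b e + real_of_int (x e)"]) auto
    qed
  qed
  then show ?thesis by metis
qed

text \<open>
  A circuit with the signs of \<open>z\<close> is directed in \<open>X\<close>, and its negative is directed in \<open>Y\<close>.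
\<close>

lemma compatible_no_difference:
  assumes X: "X \<in> orients E" "signature_compatible E \<C> w X" and Y: "Y \<in> orients E" "signature_compatible E \<C> w Y"
    and z: "z \<in> perp E \<D>"
      "\<And>e. z e \<noteq> 0 \<Longrightarrow> real_of_int (X e) - real_of_int (Y e) = 2 * z e"
    and e: "e \<in> E"
  shows "z e = 0"
proof (rule ccontr)
  assume "z e \<noteq> 0"
  then obtain C where C: "C \<in> \<C>" "\<And>f. f \<in> supp C \<Longrightarrow> real_of_int (C f) * z f > 0"
    using conformal_circuit[OF z(1) e] by metis
  have "X f = C f \<and> Y f = - C f" if f: "f \<in> supp C" for f
  proof -
    have "f \<in> E" using f C(1) supp_subset by blast
    then have "X f \<in> {1, - 1}" "Y f \<in> {1, - 1}" using X Y by (auto simp: orients_def)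
    moreover have "C f \<in> {1, - 1}" using signs[of C f] C(1) f by (auto simp: supp_def)
    moreover have "z f \<noteq> 0" using C(2)[OF f] by auto
    ultimately show ?thesis using C(2)[OF f] z(2)[of f] by (auto simp: zero_less_mult_iff)
  qed
  then have "conforms X C" "conforms Y (\<lambda>f. - C f)" by (auto simp: conforms_def supp_def)
  with X(2) Y(2) C(1) circuit_neg[OF C(1)]
  have "dot E w (real_vec C) > 0" "dot E w (real_vec (\<lambda>f. - C f)) > 0"
    by (auto simp: signature_compatible_def simp del: of_int_minus)
  then show False by (simp add: dot_minus_right)
qed

lemma compatible_unique:
  assumes X: "X \<in> orients E" "signature_compatible E \<C> w X" "signature_compatible E \<D> w' X"
    and Y: "signature_compatible E \<C> w Y" "signature_compatible E \<D> w' Y"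
    and eq: "equivclp (flips (\<C> \<union> \<D>)) X Y"
  shows "X = Y"
proof
  fix e
  obtain z b where Y': "Y \<in> orients E" and zb: "z \<in> perp E \<D>" "b \<in> perp E \<C>"
    "\<And>e. real_of_int (X e) - real_of_int (Y e) = 2 * (z e + b e)" "\<And>e. z e = 0 \<or> b e = 0"
    using equivalent_difference[OF eq X(1)] by blast
  have zdiff: "real_of_int (X e) - real_of_int (Y e) = 2 * z e" if "z e \<noteq> 0" for e
    using zb(3)[of e] zb(4)[of e] that by auto
  have bdiff: "real_of_int (X e) - real_of_int (Y e) = 2 * b e" if "b e \<noteq> 0" for e
    using zb(3)[of e] zb(4)[of e] that by auto
  show "X e = Y e"
  proof (cases "e \<in> E")
    case True
    have "z e = 0" by (rule compatible_no_difference[OF X(1,2) Y' Y(1) zb(1) zdiff True])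
    moreover have "b e = 0"
      by (rule regular_matroid.compatible_no_difference[OF dual X(1,3) Y' Y(2) zb(2) bdiff True])
    ultimately show ?thesis using zb(3)[of e] by simp
  next
    case False
    then show ?thesis using X(1) Y' by (auto simp: orients_def)
  qed
qed

lemma maximal_compatible:
  assumes generic: "\<And>x. x \<in> \<A> \<Longrightarrow> dot E w (real_vec x) \<noteq> 0"
    and max: "\<And>x. x \<in> \<A> \<Longrightarrow> conforms Y x \<Longrightarrow>
      dot E w (real_vec (flip Y x)) \<le> dot E w (real_vec Y)"
  shows "signature_compatible E \<A> w Y"
  unfolding signature_compatible_def
proof (intro ballI impI)
  fix x assume x: "x \<in> \<A>" "conforms Y x"
  have "dot E w (real_vec (flip Y x)) = dot E w (real_vec Y) - 2 * dot E w (real_vec x)"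
    by (simp add: flip_eq[OF x(2)] dot_linear)
  with max[OF x] generic[OF x(1)] show "dot E w (real_vec x) > 0" by simp
qed

text \<open>
  Maximize \<open>w'\<close> over the class, then \<open>w\<close> over the members that are compatible with \<open>w'\<close>. The second
  step stays inside those members because circuit reversals do not affect directed cocircuits.
\<close>

lemma compatible_exists:
  assumes w: "\<And>C. C \<in> \<C> \<Longrightarrow> dot E w (real_vec C) \<noteq> 0"
    and w': "\<And>D. D \<in> \<D> \<Longrightarrow> dot E w' (real_vec D) \<noteq> 0"
    and X: "X \<in> orients E"
  obtains Y where "equivclp (flips (\<C> \<union> \<D>)) X Y" "Y \<in> orients E"
    "signature_compatible E \<C> w Y" "signature_compatible E \<D> w' Y"
proof -
  define K where "K = {Y. equivclp (flips (\<C> \<union> \<D>)) X Y}"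
  have K: "K \<subseteq> orients E" using equivalent_difference X by (auto simp: K_def)
  have flip_K: "flip Y x \<in> K" if "Y \<in> K" "x \<in> \<C> \<union> \<D>" "conforms Y x" for Y x
    using that unfolding K_def
    by (auto simp: flips_def intro!: equivclp_into_equivclp[of _ X Y])
  have fin: "finite K" using K finite_orients[OF finite_E] finite_subset by blast
  have "X \<in> K" by (simp add: K_def)
  then obtain Y\<^sub>1 where Y1: "Y\<^sub>1 \<in> K"
    "\<And>Y. Y \<in> K \<Longrightarrow> dot E w' (real_vec Y) \<le> dot E w' (real_vec Y\<^sub>1)"
    using ex_maximum[OF fin, of "\<lambda>Y. dot E w' (real_vec Y)"] by auto
  define L where "L = {Y \<in> K. signature_compatible E \<D> w' Y}"
  have "signature_compatible E \<D> w' Y\<^sub>1"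
    using w' Y1 flip_K by (intro maximal_compatible) auto
  then have "L \<noteq> {}" "finite L" using Y1(1) fin by (auto simp: L_def)
  then obtain Y where Y: "Y \<in> L"
    "\<And>Y'. Y' \<in> L \<Longrightarrow> dot E w (real_vec Y') \<le> dot E w (real_vec Y)"
    using ex_maximum[of L "\<lambda>Y. dot E w (real_vec Y)"] by auto
  have YL: "Y \<in> K" "signature_compatible E \<D> w' Y" using Y(1) by (auto simp: L_def)
  have "signature_compatible E \<C> w Y"
  proof (rule maximal_compatible[OF w])
    fix C assume C: "C \<in> \<C>" "conforms Y C"
    have "flip Y C \<in> L"
      using flip_K[OF YL(1)] C YL(2) circuit_flip_keeps_cocircuits[OF C]
      by (auto simp: L_def signature_compatible_def)
    then show "dot E w (real_vec (flip Y C)) \<le> dot E w (real_vec Y)" by (rule Y(2))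
  qed
  then show thesis using that[of Y] YL K by (auto simp: K_def)
qed

text \<open>
  The basis orientations are exactly the compatible ones, of which each class contains exactly one.
\<close>

lemma basis_orientations_represent_classes:
  assumes \<sigma>: "positive_signature E \<C> \<sigma> w" and \<sigma>': "positive_signature E \<D> \<sigma>' w'"
  shows "\<And>T. basis T \<Longrightarrow> basis_orientation \<sigma> \<sigma>' T \<in> orients E"
    and "\<And>T\<^sub>1 T\<^sub>2. basis T\<^sub>1 \<Longrightarrow> basis T\<^sub>2 \<Longrightarrow>
      equivclp (flips (\<C> \<union> \<D>)) (basis_orientation \<sigma> \<sigma>' T\<^sub>1) (basis_orientation \<sigma> \<sigma>' T\<^sub>2) \<Longrightarrow>
      T\<^sub>1 = T\<^sub>2"
    and "\<And>X. X \<in> orients E \<Longrightarrow>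
      \<exists>T. basis T \<and> equivclp (flips (\<C> \<union> \<D>)) X (basis_orientation \<sigma> \<sigma>' T)"
proof -
  note compat = basis_orientation_compatible[OF _ \<sigma> \<sigma>']
  show "basis_orientation \<sigma> \<sigma>' T \<in> orients E" if "basis T" for T
    using compat(1)[OF that] .
  show "T\<^sub>1 = T\<^sub>2" if T: "basis T\<^sub>1" "basis T\<^sub>2"
    and eq: "equivclp (flips (\<C> \<union> \<D>)) (basis_orientation \<sigma> \<sigma>' T\<^sub>1) (basis_orientation \<sigma> \<sigma>' T\<^sub>2)"
    for T\<^sub>1 T\<^sub>2
    using basis_orientation_inj[OF T \<sigma> \<sigma>'] compatible_unique[OF compat[OF T(1)] compat(2,3)[OF T(2)] eq]
    by simp
  show "\<exists>T. basis T \<and> equivclp (flips (\<C> \<union> \<D>)) X (basis_orientation \<sigma> \<sigma>' T)"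
    if X: "X \<in> orients E" for X
  proof -
    obtain Y where "equivclp (flips (\<C> \<union> \<D>)) X Y" "Y \<in> orients E"
      "signature_compatible E \<C> w Y" "signature_compatible E \<D> w' Y"
      using compatible_exists[OF positive_signature_generic[OF \<sigma>]
          regular_matroid.positive_signature_generic[OF dual \<sigma>'] X] by metis
    with compatible_is_basis_orientation[OF \<sigma> \<sigma>'] show ?thesis by metis
  qed
qed

end

section \<open>Cycles of a graph\<close>

definition edge_sign :: "bool \<Rightarrow> int" where
  "edge_sign d = (if d then 1 else - 1)"

lemma traversals_simps [simp]:
  "verts (traversals G) = verts G" "arcs (traversals G) = arcs G \<times> UNIV"
  "tail (traversals G) (e, d) = (if d then tail G e else head G e)"
  "head (traversals G) (e, d) = (if d then head G e else tail G e)"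
  by (auto simp: traversals_def)

lemma wf_traversals: "wf_digraph G \<Longrightarrow> wf_digraph (traversals G)"
  unfolding wf_digraph_def by auto

lemma walk_vector_sign:
  assumes "distinct (map fst p)" "(e, d) \<in> set p"
  shows "walk_vector p e = edge_sign d"
proof -
  have "(e, \<not> d) \<notin> set p"
    using assms eq_key_imp_eq_value[of p e d "\<not> d"] by auto
  with assms(2) show ?thesis by (cases d) (auto simp: walk_vector_def edge_sign_def)
qed

lemma supp_walk_vector: "supp (walk_vector p) = fst ` set p"
proof (rule set_eqI)
  fix e
  have "e \<in> fst ` set p \<longleftrightarrow> (\<exists>d. (e, d) \<in> set p)" by force
  also have "\<dots> \<longleftrightarrow> (e, True) \<in> set p \<or> (e, False) \<in> set p" by (simp add: ex_bool_eq)
  finally show "e \<in> supp (walk_vector p) \<longleftrightarrow> e \<in> fst ` set p"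
    by (simp add: supp_def walk_vector_def)
qed

lemma supp_cut_vector: "supp (cut_vector G S) = cut G S"
  by (auto simp: supp_def cut_vector_def)

text \<open>
  Simple closed walks without a designated initial vertex: the vertices are read off as the heads.
\<close>

definition closed_walk :: "('a, 'b) pre_digraph \<Rightarrow> ('b \<times> bool) list \<Rightarrow> bool" where
  "closed_walk G p \<longleftrightarrow> p \<noteq> [] \<and> set p \<subseteq> arcs (traversals G) \<and> distinct (map fst p) \<and>
     distinct (map (head (traversals G)) p) \<and> (\<exists>u. pre_digraph.cas (traversals G) u p u)"

lemma closed_walk_iff:
  assumes "wf_digraph G"
  shows "closed_walk G p \<longleftrightarrow> pre_digraph.cycle (traversals G) p \<and> distinct (map fst p)"
proof -
  interpret H: wf_digraph "traversals G" using assms by (rule wf_traversals)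
  have tl_verts: "tl (H.awalk_verts u p) = map (head (traversals G)) p" if "H.cas u p u" for u
    using that by (simp add: H.awalk_verts_conv'[OF that])
  have "u \<in> verts G" if "H.cas u p u" "p \<noteq> []" "set p \<subseteq> arcs (traversals G)" for u
    using that H.tail_in_verts[of "hd p"] by (cases p) auto
  then have "H.cas u p u \<and> p \<noteq> [] \<and> set p \<subseteq> arcs (traversals G) \<Longrightarrow>
      u \<in> verts (traversals G) \<and> tl (H.awalk_verts u p) = map (head (traversals G)) p" for u
    using tl_verts by simp
  then show ?thesis
    unfolding closed_walk_def H.cycle_def H.awalk_def by metis
qed

lemma directed_cycles_eq:
  "wf_digraph G \<Longrightarrow> directed_cycles G = walk_vector ` {p. closed_walk G p}"
  by (auto simp: directed_cycles_def closed_walk_iff)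

lemma cas_append:
  "pre_digraph.cas H u p v \<Longrightarrow> pre_digraph.cas H v q w \<Longrightarrow> pre_digraph.cas H u (p @ q) w"
  by (induction p arbitrary: u) (auto simp: pre_digraph.cas.simps)

lemma tails_heads: "pre_digraph.cas H u p v \<Longrightarrow> map (tail H) p @ [v] = u # map (head H) p"
  by (induction p arbitrary: u) (auto simp: pre_digraph.cas.simps)

lemma sum_list_potential:
  fixes \<phi> :: "'v \<Rightarrow> real"
  shows "pre_digraph.cas H u p v \<Longrightarrow>
    (\<Sum>x\<leftarrow>p. \<phi> (tail H x) - \<phi> (head H x)) = \<phi> u - \<phi> v"
  by (induction p arbitrary: u) (auto simp: pre_digraph.cas.simps)

definition turn :: "'b \<times> bool \<Rightarrow> 'b \<times> bool" where
  "turn = (\<lambda>(e, d). (e, \<not> d))"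

lemma turn_simps [simp]:
  "fst (turn x) = fst x"
  "tail (traversals G) (turn x) = head (traversals G) x"
  "head (traversals G) (turn x) = tail (traversals G) x"
  by (cases x; simp add: turn_def)+

lemma cas_reverse:
  "pre_digraph.cas (traversals G) u p v \<Longrightarrow> pre_digraph.cas (traversals G) v (rev (map turn p)) u"
proof (induction p arbitrary: u)
  case (Cons x p)
  then have "pre_digraph.cas (traversals G) v (rev (map turn p)) (head (traversals G) x)"
    by (simp add: pre_digraph.cas.simps)
  moreover have "pre_digraph.cas (traversals G) (head (traversals G) x) [turn x] u"
    using Cons.prems by (simp add: pre_digraph.cas.simps)
  ultimately show ?case by (simp add: cas_append)
qed (simp add: pre_digraph.cas.simps)

lemma closed_walk_reverse:
  assumes p: "closed_walk G p"
  shows "closed_walk G (rev (map turn p))" "walk_vector (rev (map turn p)) = (\<lambda>e. - walk_vector p e)"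
proof -
  let ?H = "traversals G"
  obtain u where u: "pre_digraph.cas ?H u p u" using p by (auto simp: closed_walk_def)
  have "mset (map (tail ?H) p @ [u]) = mset (u # map (head ?H) p)"
    by (simp only: tails_heads[OF u])
  then have "mset (map (tail ?H) p) = mset (map (head ?H) p)" by simp
  then have "distinct (map (tail ?H) p)"
    using p mset_eq_imp_distinct_iff closed_walk_def by metis
  moreover have "map (head ?H) (map turn p) = map (tail ?H) p" "map fst (map turn p) = map fst p"
    by auto
  moreover have "set (map turn p) \<subseteq> arcs ?H"
    using p by (auto simp: closed_walk_def turn_def)
  ultimately show "closed_walk G (rev (map turn p))"
    using p cas_reverse[OF u] by (auto simp: closed_walk_def simp del: map_map simp flip: rev_map)
  have turn_mem: "(e, d) \<in> set (map turn p) \<longleftrightarrow> (e, \<not> d) \<in> set p" for e d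
    by (force simp: turn_def)
  show "walk_vector (rev (map turn p)) = (\<lambda>e. - walk_vector p e)"
  proof
    fix e
    have "distinct (map fst p)" using p by (simp add: closed_walk_def)
    then have "\<not> ((e, True) \<in> set p \<and> (e, False) \<in> set p)"
      using eq_key_imp_eq_value[of p e True False] by auto
    then show "walk_vector (rev (map turn p)) e = - walk_vector p e"
      using turn_mem[of e] by (auto simp: walk_vector_def)
  qed
qed

text \<open>
  A cut vector is the difference of a potential, the indicator of \<open>S\<close>, along each edge; the sum around
  a closed walk telescopes.
\<close>

lemma cycle_cut_orthogonal:
  assumes fin: "finite (arcs G)" and p: "closed_walk G p"
  shows "dot (arcs G) (real_vec (walk_vector p)) (real_vec (cut_vector G S)) = 0"
proof -
  let ?H = "traversals G"
  define \<phi> where "\<phi> v = (if v \<in> S then 1 else 0 :: real)" for v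
  obtain u where u: "pre_digraph.cas ?H u p u" using p by (auto simp: closed_walk_def)
  have dist: "distinct (map fst p)" and sub: "set p \<subseteq> arcs ?H" using p by (auto simp: closed_walk_def)
  have "dot (arcs G) (real_vec (walk_vector p)) (real_vec (cut_vector G S)) =
      (\<Sum>e\<in>fst ` set p. real_of_int (walk_vector p e) * real_of_int (cut_vector G S e))"
    unfolding dot_def
  proof (rule sum.mono_neutral_right[OF fin])
    show "fst ` set p \<subseteq> arcs G" using sub by auto
    show "\<forall>e\<in>arcs G - fst ` set p. real_vec (walk_vector p) e * real_vec (cut_vector G S) e = 0"
      using supp_walk_vector[of p] by (auto simp: supp_def)
  qed
  also have "\<dots> = (\<Sum>x\<in>set p. \<phi> (tail ?H x) - \<phi> (head ?H x))"
  proof (rule sum.reindex_cong[of fst])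
    show "inj_on fst (set p)" using dist by (simp add: distinct_map)
    fix x assume x: "x \<in> set p"
    obtain e d where ed: "x = (e, d)" by (cases x)
    have "e \<in> arcs G" using x sub ed by auto
    then show "real_vec (walk_vector p) (fst x) * real_vec (cut_vector G S) (fst x) =
        \<phi> (tail ?H x) - \<phi> (head ?H x)"
      using walk_vector_sign[OF dist, of e d] x ed
      by (auto simp: edge_sign_def cut_vector_def cut_def \<phi>_def)
  qed simp
  also have "\<dots> = (\<Sum>x\<leftarrow>p. \<phi> (tail ?H x) - \<phi> (head ?H x))"
    using dist by (simp add: sum_list_distinct_conv_sum_set distinct_map)
  also have "\<dots> = 0" using sum_list_potential[OF u] by simp
  finally show ?thesis .
qed

text \<open>
  The vertices of the stretch of the cycle from one edge to the other form such a set.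
\<close>

lemma cut_separates_cycle_edges:
  assumes wf: "wf_digraph G" and p: "closed_walk G p"
    and ij: "i < j" "j < length p"
  shows "\<exists>S\<subseteq>verts G. cut G S \<inter> fst ` set p = {fst (p ! i), fst (p ! j)}"
proof -
  let ?H = "traversals G"
  interpret H: wf_digraph ?H using wf by (rule wf_traversals)
  obtain u where u: "pre_digraph.cas ?H u p u" using p by (auto simp: closed_walk_def)
  have dist: "distinct (map (head ?H) p)" and sub: "set p \<subseteq> arcs ?H" using p by (auto simp: closed_walk_def)
  define S where "S = (\<lambda>k. head ?H (p ! k)) ` {i..<j}"
  have head_S: "head ?H (p ! m) \<in> S \<longleftrightarrow> i \<le> m \<and> m < j" if m: "m < length p" for m
  proof
    assume "head ?H (p ! m) \<in> S"
    then obtain k where k: "i \<le> k" "k < j" "head ?H (p ! m) = head ?H (p ! k)" by (auto simp: S_def)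
    then have "m = k" using nth_eq_iff_index_eq[OF dist, of m k] m ij by simp
    with k show "i \<le> m \<and> m < j" by simp
  qed (auto simp: S_def)
  have tail_S: "tail ?H (p ! m) \<in> S \<longleftrightarrow> i < m \<and> m \<le> j" if m: "m < length p" for m
  proof (cases m)
    case 0
    have "tail ?H (p ! 0) = u" using u m by (cases p) (auto simp: pre_digraph.cas.simps)
    moreover have "head ?H (p ! (length p - 1)) = u"
      using arg_cong[OF tails_heads[OF u], of last] m by (cases p rule: rev_cases) auto
    ultimately show ?thesis using head_S[of "length p - 1"] m ij 0 by auto
  next
    case (Suc k)
    have "tail ?H (p ! m) = (map (tail ?H) p @ [u]) ! m" using m by (simp add: nth_append)
    also have "\<dots> = head ?H (p ! k)" using m Suc by (simp add: tails_heads[OF u])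
    finally show ?thesis using head_S[of k] m Suc by auto
  qed
  have cut_iff: "fst (p ! m) \<in> cut G S \<longleftrightarrow> m = i \<or> m = j" if m: "m < length p" for m
  proof -
    obtain e d where ed: "p ! m = (e, d)" by (cases "p ! m")
    have "e \<in> arcs G" using sub nth_mem[OF m] ed by auto
    then have "e \<in> cut G S \<longleftrightarrow> (tail ?H (e, d) \<in> S) \<noteq> (head ?H (e, d) \<in> S)"
      by (auto simp: cut_def)
    then show ?thesis using head_S[OF m] tail_S[OF m] ed ij by auto
  qed
  have "S \<subseteq> verts G"
  proof
    fix v assume "v \<in> S"
    then obtain k where "k \<in> {i..<j}" "v = head ?H (p ! k)" unfolding S_def by blast
    then have k: "k < length p" "v = head ?H (p ! k)" using ij by auto
    then show "v \<in> verts G" using H.head_in_verts[of "p ! k"] subsetD[OF sub nth_mem[OF k(1)]] by simp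
  qed
  moreover have "cut G S \<inter> fst ` set p = {fst (p ! i), fst (p ! j)}"
  proof (intro equalityI subsetI)
    fix e assume e: "e \<in> cut G S \<inter> fst ` set p"
    then obtain m where m: "m < length p" "e = fst (p ! m)" by (auto simp: in_set_conv_nth)
    with cut_iff[OF m(1)] e show "e \<in> {fst (p ! i), fst (p ! j)}" by auto
  next
    fix e assume "e \<in> {fst (p ! i), fst (p ! j)}"
    then consider "e = fst (p ! i)" | "e = fst (p ! j)" by blast
    then show "e \<in> cut G S \<inter> fst ` set p"
      using cut_iff[of i] cut_iff[of j] nth_mem[of i p] nth_mem[of j p] ij by cases simp_all
  qed
  ultimately show ?thesis by blast
qed

text \<open>
  For any two edges of \<open>p\<close>, the cycle \<open>q\<close> is orthogonal to a cut that meets \<open>p\<close> in just these two.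
  So \<open>q\<close> uses both of them or neither.
\<close>

lemma simple_cycle_minimal:
  assumes wf: "wf_digraph G" and fin: "finite (arcs G)"
    and p: "closed_walk G p" and q: "closed_walk G q"
    and sub: "supp (walk_vector q) \<subseteq> supp (walk_vector p)"
  shows "supp (walk_vector q) = supp (walk_vector p)"
proof -
  let ?y = "walk_vector q"
  have y_iff: "?y (fst (p ! i)) = 0 \<longleftrightarrow> ?y (fst (p ! j)) = 0" if ij: "i < j" "j < length p" for i j
  proof -
    obtain S where S: "cut G S \<inter> fst ` set p = {fst (p ! i), fst (p ! j)}"
      using cut_separates_cycle_edges[OF wf p ij] by blast
    have neq: "fst (p ! i) \<noteq> fst (p ! j)"
      using p ij nth_eq_iff_index_eq[of "map fst p" i j] by (auto simp: closed_walk_def)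
    let ?f = "\<lambda>e. real_of_int (?y e) * real_of_int (cut_vector G S e)"
    have "dot (arcs G) (real_vec ?y) (real_vec (cut_vector G S)) = sum ?f {fst (p ! i), fst (p ! j)}"
      unfolding dot_def
    proof (rule sum.mono_neutral_right[OF fin])
      show "{fst (p ! i), fst (p ! j)} \<subseteq> arcs G" using S by (auto simp: cut_def)
      show "\<forall>e\<in>arcs G - {fst (p ! i), fst (p ! j)}. ?f e = 0"
      proof
        fix e assume "e \<in> arcs G - {fst (p ! i), fst (p ! j)}"
        then have "e \<notin> cut G S \<or> e \<notin> supp ?y" using S sub supp_walk_vector[of p] by blast
        then show "?f e = 0" by (auto simp: cut_vector_def supp_def)
      qed
    qed
    then have "?f (fst (p ! i)) + ?f (fst (p ! j)) = 0"
      using cycle_cut_orthogonal[OF fin q] neq by simp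
    moreover have "cut_vector G S (fst (p ! i)) \<noteq> 0" "cut_vector G S (fst (p ! j)) \<noteq> 0"
      using S supp_cut_vector[of G S] by (auto simp: supp_def)
    ultimately show ?thesis by auto
  qed
  have "supp ?y \<noteq> {}" using q by (auto simp: closed_walk_def supp_walk_vector)
  then obtain x where x: "x \<in> set p" "fst x \<in> supp ?y"
    using sub unfolding supp_walk_vector[of p] by blast
  then obtain i where "i < length p" "x = p ! i" by (auto simp: in_set_conv_nth)
  then have i: "i < length p" "?y (fst (p ! i)) \<noteq> 0" using x(2) by (auto simp: supp_def)
  have nonzero: "?y (fst (p ! j)) \<noteq> 0" if j: "j < length p" for j
  proof (rule linorder_cases[of i j])
    show ?thesis if "i < j" using y_iff[OF that j] i by blast
    show ?thesis if "i = j" using that i by blast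
    show ?thesis if "j < i" using y_iff[OF that i(1)] i(2) by blast
  qed
  have "fst x \<in> supp ?y" if "x \<in> set p" for x
    using that nonzero by (auto simp: in_set_conv_nth supp_def)
  then have "supp (walk_vector p) \<subseteq> supp ?y" unfolding supp_walk_vector[of p] by blast
  with sub show ?thesis by blast
qed

section \<open>Bonds, connectivity and spanning trees\<close>

lemma wf_restrict_arcs: "wf_digraph G \<Longrightarrow> A \<subseteq> arcs G \<Longrightarrow> wf_digraph (G\<lparr>arcs := A\<rparr>)"
  unfolding wf_digraph_def by auto

text \<open>
  The vertices reachable from a given one by edges in either direction form a set with empty cut.
\<close>

lemma connected_iff_cuts:
  assumes wf: "wf_digraph G"
  shows "Digraph_Component.connected G \<longleftrightarrow>
    verts G \<noteq> {} \<and> (\<forall>S\<subseteq>verts G. cut G S = {} \<longrightarrow> S = {} \<or> S = verts G)"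
proof -
  interpret wf_digraph G by (rule wf)
  let ?R = "arcs_ends (with_proj (mk_symmetric G))"
  have R: "?R = {(tail G e, head G e) | e. e \<in> arcs G} \<union> {(head G e, tail G e) | e. e \<in> arcs G}"
    by (auto simp: mk_symmetric_def)
  have V: "verts (with_proj (mk_symmetric G)) = verts G" by (simp add: mk_symmetric_def)
  have reach: "u \<rightarrow>\<^sup>*\<^bsub>with_proj (mk_symmetric G)\<^esub> v \<longleftrightarrow> (u, v) \<in> rtrancl_on (verts G) ?R" for u v
    by (simp only: reachable_def V)
  show ?thesis
  proof (intro iffI conjI allI impI)
    assume con: "Digraph_Component.connected G"
    then show "verts G \<noteq> {}" by (auto simp: connected_def strongly_connected_def V)
    fix S assume S: "S \<subseteq> verts G" "cut G S = {}"
    have stay: "v \<in> S" if "(u, v) \<in> rtrancl_on (verts G) ?R" "u \<in> S" for u v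
      using that
    proof (induction rule: rtrancl_on_induct)
      case (step y z)
      from step.hyps(2) obtain e where e: "e \<in> arcs G"
        "y = tail G e \<and> z = head G e \<or> y = head G e \<and> z = tail G e" unfolding R by blast
      then have "e \<notin> cut G S" using S(2) by blast
      then show ?case using e step.IH step.prems by (auto simp: cut_def)
    qed
    have "(u, v) \<in> rtrancl_on (verts G) ?R" if "u \<in> verts G" "v \<in> verts G" for u v
      using con that reach by (auto simp: connected_def strongly_connected_def V)
    then show "S = {} \<or> S = verts G" using stay S(1) by blast
  next
    assume cuts: "verts G \<noteq> {} \<and> (\<forall>S\<subseteq>verts G. cut G S = {} \<longrightarrow> S = {} \<or> S = verts G)"
    have "(u, v) \<in> rtrancl_on (verts G) ?R" if uv: "u \<in> verts G" "v \<in> verts G" for u v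
    proof -
      define S where "S = {x \<in> verts G. (u, x) \<in> rtrancl_on (verts G) ?R}"
      have closed: "y \<in> S" if "x \<in> S" "(x, y) \<in> ?R" for x y
      proof -
        have "y \<in> verts G" using that(2) unfolding R by auto
        then show ?thesis using that by (auto simp: S_def intro: rtrancl_on_into_rtrancl_on)
      qed
      have "cut G S = {}"
        using closed unfolding R cut_def by blast
      moreover have "u \<in> S" using uv by (simp add: S_def)
      moreover have "S \<subseteq> verts G" by (auto simp: S_def)
      ultimately have "S = verts G" using cuts by blast
      then have "v \<in> S" using uv by simp
      then show ?thesis by (simp add: S_def)
    qed
    then show "Digraph_Component.connected G"
      using cuts reach by (auto simp: connected_def strongly_connected_def V)
  qed
qed

definition cut_conforms :: "('a, 'b) pre_digraph \<Rightarrow> 'a set \<Rightarrow> 'a set \<Rightarrow> bool" where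
  "cut_conforms G S' S \<longleftrightarrow> (\<forall>f\<in>cut G S'. f \<in> cut G S \<and> (tail G f \<in> S' \<longleftrightarrow> tail G f \<in> S))"

lemma cut_complement: "wf_digraph G \<Longrightarrow> cut G (verts G - S) = cut G S"
  by (auto simp: cut_def wf_digraph_def)

text \<open>
  Among the cuts through \<open>e\<close> that conform to the cut of \<open>S\<close>, one with fewest edges is a bond. Let it be
  the cut of \<open>U\<close> and let it contain the nonempty cut of \<open>W\<close>. The intersections of \<open>W\<close> and its complement
  with \<open>U\<close> have conforming cuts; the one with \<open>e\<close> on its boundary has, by minimality, the same cut as
  \<open>U\<close>, and then connectivity forces it to be all of \<open>U\<close>. The same reasoning outside \<open>U\<close> gives equality.
\<close>

lemma bond_in_cut:
  assumes wf: "wf_digraph G" and fin: "finite (arcs G)"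
    and con: "Digraph_Component.connected G"
    and S: "S \<subseteq> verts G" and e: "e \<in> cut G S"
  shows "\<exists>S'\<subseteq>verts G. cut G S' \<in> bonds G \<and> e \<in> cut G S' \<and> cut_conforms G S' S"
proof -
  interpret wf_digraph G by (rule wf)
  define P where "P U \<longleftrightarrow> U \<subseteq> verts G \<and> e \<in> cut G U \<and> cut_conforms G U S" for U
  have PS: "P S" using S e by (auto simp: P_def cut_conforms_def)
  obtain U where U: "P U" "\<And>U'. P U' \<Longrightarrow> card (cut G U) \<le> card (cut G U')"
    using ex_has_least_nat[of P S "\<lambda>U. card (cut G U)", OF PS] by blast
  have UV: "U \<subseteq> verts G" "e \<in> cut G U" using U(1) by (auto simp: P_def)
  have fin_cut: "finite (cut G A)" for A using fin by (auto simp: cut_def)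
  have triv: "A = {} \<or> A = verts G" if "A \<subseteq> verts G" "cut G A = {}" for A
    using con connected_iff_cuts[OF wf] that by blast
  have minimal: "cut G A = cut G U" if A: "A \<subseteq> verts G" "e \<in> cut G A" "cut_conforms G A U" for A
  proof -
    have "P A" using U(1) A by (auto simp: P_def cut_conforms_def)
    moreover have "cut G A \<subseteq> cut G U" using A(3) by (auto simp: cut_conforms_def)
    ultimately show ?thesis using U(2) fin_cut by (intro card_seteq) auto
  qed
  have main: "cut G W = cut G U"
    if W: "W \<subseteq> verts G" "cut G W \<noteq> {}" "cut G W \<subseteq> cut G U" and eW: "e \<in> cut G (U \<inter> W)" for W
  proof -
    have "cut_conforms G (U \<inter> W) U" using W(3) by (auto simp: cut_conforms_def cut_def)
    then have inter: "cut G (U \<inter> W) = cut G U" using minimal[of "U \<inter> W"] UV eW by auto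
    have "cut G (U - W) = {}" using inter W(3) unfolding cut_def by blast
    then have "U - W = {} \<or> U - W = verts G" using triv UV by blast
    moreover have "U - W \<noteq> verts G" using UV eW by (auto simp: cut_def)
    ultimately have UW: "U \<subseteq> W" by blast
    show ?thesis
    proof (cases "e \<in> cut G W")
      case True
      have "cut_conforms G W U" using W(3) UW by (auto simp: cut_conforms_def cut_def)
      then show ?thesis using minimal W(1) True by blast
    next
      case False
      let ?A = "verts G - (W - U)"
      have cutA: "cut G ?A = cut G (W - U)" by (rule cut_complement[OF wf])
      have "e \<in> cut G (W - U)" using False UV(2) UW by (auto simp: cut_def)
      moreover have "cut_conforms G ?A U"
        unfolding cut_conforms_def cutA using W(3) UW UV(1) tail_in_verts head_in_verts
        by (auto simp: cut_def)
      ultimately have "cut G (W - U) = cut G U" using minimal[of ?A] cutA by auto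
      then have "cut G W = {}" using W(3) UW unfolding cut_def by blast
      with W(2) show ?thesis by blast
    qed
  qed
  have "cut G W = cut G U" if W: "W \<subseteq> verts G" "cut G W \<noteq> {}" "cut G W \<subseteq> cut G U" for W
  proof (cases "e \<in> cut G (U \<inter> W)")
    case True
    then show ?thesis using main W by blast
  next
    case False
    have "e \<in> cut G (U \<inter> (verts G - W))"
      using UV False tail_in_verts head_in_verts by (auto simp: cut_def)
    with main[of "verts G - W"] W show ?thesis by (auto simp: cut_complement[OF wf])
  qed
  then have "cut G U \<in> bonds G" using UV unfolding bonds_def by blast
  with U(1) show ?thesis by (auto simp: P_def)
qed

text \<open>
  A path from the head of \<open>e\<close> back to its tail closes up to a cycle. A path never uses an edge in both
  directions, as this would revisit a vertex; the edge \<open>e\<close> itself has to be excluded by the assumption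
  that its other direction is not available.
\<close>

lemma closed_walk_of_apath:
  assumes wf: "wf_digraph G" and A: "A \<subseteq> arcs G \<times> UNIV"
    and ed: "(e, d) \<in> A" "(e, \<not> d) \<notin> A"
    and path: "pre_digraph.apath ((traversals G)\<lparr>arcs := A\<rparr>)
      (head (traversals G) (e, d)) p (tail (traversals G) (e, d))"
  shows "closed_walk G ((e, d) # p)" "set p \<subseteq> A"
proof -
  let ?H = "traversals G" and ?K = "(traversals G)\<lparr>arcs := A\<rparr>"
  let ?v = "head ?H (e, d)" and ?u = "tail ?H (e, d)"
  interpret K: wf_digraph ?K
    using wf_restrict_arcs[OF wf_traversals[OF wf]] A by simp
  have cas: "K.cas ?v p ?u" and sub: "set p \<subseteq> A" and dist: "distinct (K.awalk_verts ?v p)"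
    using path by (auto simp: K.apath_def K.awalk_def)
  show "set p \<subseteq> A" by (rule sub)
  have cas_eq: "K.cas a q b = pre_digraph.cas ?H a q b" for a q b
    by (induction q arbitrary: a) (auto simp: pre_digraph.cas.simps)
  have verts1: "K.awalk_verts ?v p = ?v # map (head ?H) p"
    using K.awalk_verts_conv'[OF cas] cas by (cases p) auto
  have verts2: "K.awalk_verts ?v p = map (tail ?H) p @ [?u]"
    using tails_heads[of ?H ?v p ?u] cas verts1 by (simp add: cas_eq)
  have p_dist: "distinct p" using dist unfolding verts1 by (auto simp: distinct_map)
  have no_turn: "(f, \<not> b) \<notin> set p" if fb: "(f, b) \<in> set p" for f b
  proof
    assume "(f, \<not> b) \<in> set p"
    then obtain j where j: "j < length p" "p ! j = (f, \<not> b)" by (auto simp: in_set_conv_nth)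
    obtain i where i: "i < length p" "p ! i = (f, b)" using fb by (auto simp: in_set_conv_nth)
    let ?w = "K.awalk_verts ?v p"
    have len: "length ?w = Suc (length p)" unfolding verts1 by simp
    have tail: "?w ! k = tail ?H (p ! k)" if "k < length p" for k
      unfolding verts2 using that by (simp add: nth_append)
    have head: "?w ! Suc k = head ?H (p ! k)" if "k < length p" for k
      unfolding verts1 using that by simp
    have "?w ! Suc i = ?w ! j" "?w ! Suc j = ?w ! i"
      using head[OF i(1)] tail[OF i(1)] head[OF j(1)] tail[OF j(1)] i(2) j(2) by simp_all
    then have "Suc i = j" "Suc j = i"
      using nth_eq_iff_index_eq[OF dist] i(1) j(1) len by auto
    then show False by simp
  qed
  have "inj_on fst (set p)"
  proof (rule inj_onI)
    fix x y assume xy: "x \<in> set p" "y \<in> set p" "fst x = fst y"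
    obtain f b c where "x = (f, b)" "y = (f, c)" using xy(3) by (cases x; cases y) auto
    then show "x = y" using no_turn[of f b] xy(1,2) by (cases b; cases c) auto
  qed
  then have p_fst: "distinct (map fst p)"
    using p_dist by (simp add: distinct_map)
  have "e \<notin> fst ` set p"
  proof
    assume "e \<in> fst ` set p"
    then obtain b where b: "(e, b) \<in> set p" by force
    then have "b = d" using ed(2) sub by (cases "b = d") auto
    then have "?v \<in> set (map (head ?H) p)" using b by force
    then show False using dist unfolding verts1 by simp
  qed
  then have "distinct (map fst ((e, d) # p))" using p_fst by simp
  moreover have "distinct (map (head ?H) ((e, d) # p))" using dist unfolding verts1 by simp
  moreover have "pre_digraph.cas ?H ?u ((e, d) # p) ?u"
    using cas cas_eq by (simp add: pre_digraph.cas.simps)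
  moreover have "set ((e, d) # p) \<subseteq> arcs ?H" using sub ed(1) A by auto
  ultimately show "closed_walk G ((e, d) # p)" unfolding closed_walk_def by blast
qed

text \<open>
  Let \<open>R\<close> be the set of vertices reachable from the head of \<open>e\<close> by permitted traversals. Either the
  tail of \<open>e\<close> belongs to \<open>R\<close>, and a path back to it closes a permitted cycle, or \<open>e\<close> enters \<open>R\<close> and no
  permitted traversal leaves \<open>R\<close>, so a bond in the cut of \<open>R\<close> blocks \<open>e\<close>.
\<close>

lemma graph_painting:
  assumes wf: "wf_digraph G" and fin: "finite (arcs G)"
    and con: "Digraph_Component.connected G"
    and e: "e \<in> arcs G" and s: "s \<in> {1, - 1}" and F: "F e s" "\<not> F e (- s)"
  shows "(\<exists>C\<in>directed_cycles G. C e = s \<and> (\<forall>f\<in>supp C. F f (C f))) \<or>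
    (\<exists>D\<in>directed_bonds G. D e = s \<and> (\<forall>f\<in>supp D. \<not> F f (- D f)))"
proof -
  let ?H = "traversals G"
  define A where "A = {(f, b). f \<in> arcs G \<and> F f (edge_sign b)}"
  let ?K = "?H\<lparr>arcs := A\<rparr>"
  have A: "A \<subseteq> arcs G \<times> UNIV" by (auto simp: A_def)
  interpret K: wf_digraph ?K
    using wf_restrict_arcs[OF wf_traversals[OF wf]] A by simp
  define d where "d = (s = 1)"
  have d: "edge_sign d = s" "edge_sign (\<not> d) = - s" using s by (auto simp: d_def edge_sign_def)
  have ed: "(e, d) \<in> A" "(e, \<not> d) \<notin> A" using e F d by (auto simp: A_def)
  let ?v = "head ?H (e, d)" and ?u = "tail ?H (e, d)"
  have uv: "?u \<in> verts G" "?v \<in> verts G"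
    using K.tail_in_verts[of "(e, d)"] K.head_in_verts[of "(e, d)"] ed(1) by simp_all
  show ?thesis
  proof (cases "?v \<rightarrow>\<^sup>*\<^bsub>?K\<^esub> ?u")
    case True
    then obtain p where p: "K.apath ?v p ?u" using K.reachable_apath by blast
    note cw = closed_walk_of_apath[OF wf A ed p]
    let ?C = "walk_vector ((e, d) # p)"
    have dist: "distinct (map fst ((e, d) # p))" using cw(1) by (simp add: closed_walk_def)
    have "?C \<in> directed_cycles G" using cw(1) by (auto simp: directed_cycles_eq[OF wf])
    moreover have "?C e = s" using walk_vector_sign[OF dist, of e d] d by simp
    moreover have "F f (?C f)" if "f \<in> supp ?C" for f
    proof -
      have "f \<in> fst ` set ((e, d) # p)" using that unfolding supp_walk_vector .
      then obtain b where b: "(f, b) \<in> set ((e, d) # p)" by (metis imageE prod.collapse)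
      then have "(f, b) \<in> A" using cw(2) ed(1) by auto
      then show ?thesis using walk_vector_sign[OF dist b] by (simp add: A_def)
    qed
    ultimately show ?thesis by blast
  next
    case False
    define R where "R = {x \<in> verts G. ?v \<rightarrow>\<^sup>*\<^bsub>?K\<^esub> x}"
    have leave: "head ?H x \<in> R" if "x \<in> A" "tail ?H x \<in> R" for x
    proof -
      have "(tail ?H x, head ?H x) \<in> arcs_ends ?K"
        using that(1) by (auto simp: arcs_ends_def arc_to_ends_def intro!: image_eqI[of _ _ x])
      moreover have "head ?H x \<in> verts G" using K.head_in_verts[of x] that(1) by simp
      ultimately show ?thesis using that(2) K.reachable_adj_trans by (auto simp: R_def)
    qed
    have vR: "?v \<in> R" "?u \<notin> R" using False uv by (auto simp: R_def)
    have in_V: "tail G f \<in> verts G" "head G f \<in> verts G" if "f \<in> arcs G" for f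
      using wf that by (auto simp: wf_digraph_def)
    \<comment> \<open>The complement of \<open>R\<close>, so that the cut vector is directed into \<open>R\<close>, the direction of \<open>e\<close>.\<close>
    let ?S = "verts G - R"
    have "e \<in> cut G ?S" using vR uv e by (auto simp: cut_def split: if_splits)
    then obtain S where S: "S \<subseteq> verts G" "cut G S \<in> bonds G" "e \<in> cut G S" "cut_conforms G S ?S"
      using bond_in_cut[OF wf fin con, of ?S e] by blast
    let ?D = "cut_vector G S"
    have "?D \<in> directed_bonds G" using S(1,2) by (auto simp: directed_bonds_def)
    moreover have "?D e = s"
    proof -
      have "tail G e \<in> S \<longleftrightarrow> tail G e \<notin> R"
        using S(3,4) in_V[OF e] by (auto simp: cut_conforms_def)
      then show ?thesis
        using S(3) vR d(1) by (cases d) (auto simp: cut_vector_def edge_sign_def)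
    qed
    moreover have "\<not> F f (- ?D f)" if f: "f \<in> supp ?D" for f
    proof
      assume Ff: "F f (- ?D f)"
      have f: "f \<in> cut G S" using that by (simp add: supp_cut_vector)
      then have fE: "f \<in> arcs G" "f \<in> cut G ?S" "tail G f \<in> S \<longleftrightarrow> tail G f \<notin> R"
        using S(4) in_V[of f] by (auto simp: cut_conforms_def cut_def)
      have cross: "tail G f \<in> R \<longleftrightarrow> head G f \<notin> R" using fE in_V[of f] by (auto simp: cut_def)
      show False
      proof (cases "tail G f \<in> R")
        case True
        then have "(f, True) \<in> A" using Ff f fE by (auto simp: A_def cut_vector_def edge_sign_def)
        then show False using leave[of "(f, True)"] True cross by simp
      next
        case False
        then have "(f, False) \<in> A" using Ff f fE by (auto simp: A_def cut_vector_def edge_sign_def)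
        then show False using leave[of "(f, False)"] False cross by simp
      qed
    qed
    ultimately show ?thesis by blast
  qed
qed

lemma bonds_eq: "bonds G = supp ` directed_bonds G"
proof
  show "bonds G \<subseteq> supp ` directed_bonds G"
  proof
    fix B assume B: "B \<in> bonds G"
    then obtain S where S: "S \<subseteq> verts G" "B = cut G S" unfolding bonds_def by blast
    have "cut_vector G S \<in> directed_bonds G" using B S by (auto simp: directed_bonds_def)
    moreover have "B = supp (cut_vector G S)" by (simp add: S(2) supp_cut_vector)
    ultimately show "B \<in> supp ` directed_bonds G" by (metis imageI)
  qed
  show "supp ` directed_bonds G \<subseteq> bonds G"
    by (auto simp: directed_bonds_def supp_cut_vector)
qed

lemma graph_regular_matroid:
  assumes "fin_digraph G" and con: "Digraph_Component.connected G"
  shows "regular_matroid (arcs G) (directed_cycles G) (directed_bonds G)"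
proof -
  interpret fin_digraph G by fact
  have wf: "wf_digraph G" by (rule wf_digraph_axioms)
  note cycles = directed_cycles_eq[OF wf]
  have bond_supp: "supp D \<in> bonds G" if "D \<in> directed_bonds G" for D
    using that bonds_eq by blast
  show ?thesis
  proof (unfold_locales)
    show "finite (arcs G)" by simp
  next
    fix x e assume "x \<in> directed_cycles G \<union> directed_bonds G"
    then show "x e \<in> {1, - 1, 0}"
      by (auto simp: directed_cycles_def walk_vector_def directed_bonds_def cut_vector_def
          split: if_splits)
  next
    fix x assume "x \<in> directed_cycles G \<union> directed_bonds G"
    then consider p where "closed_walk G p" "x = walk_vector p"
      | S where "cut G S \<in> bonds G" "x = cut_vector G S"
      unfolding cycles directed_bonds_def by blast
    then have "supp x \<subseteq> arcs G \<and> supp x \<noteq> {}"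
    proof cases
      case 1
      then show ?thesis by (auto simp: closed_walk_def supp_walk_vector)
    next
      case 2
      then have "cut G S \<noteq> {}" by (simp add: bonds_def)
      then show ?thesis using 2 unfolding supp_cut_vector by (auto simp: cut_def supp_cut_vector)
    qed
    then show "supp x \<subseteq> arcs G" "supp x \<noteq> {}" by simp_all
  next
    fix C assume "C \<in> directed_cycles G"
    then show "(\<lambda>e. - C e) \<in> directed_cycles G"
      unfolding cycles using closed_walk_reverse by (force simp flip: closed_walk_reverse(2))
  next
    fix D assume "D \<in> directed_bonds G"
    then obtain S where S: "S \<subseteq> verts G" "cut G S \<in> bonds G" "D = cut_vector G S"
      by (auto simp: directed_bonds_def)
    have "(\<lambda>e. - D e) = cut_vector G (verts G - S)"
      using cut_complement[OF wf, of S] S(3)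
      by (auto simp: fun_eq_iff cut_vector_def cut_def)
    then show "(\<lambda>e. - D e) \<in> directed_bonds G"
      using S(2) cut_complement[OF wf, of S] by (auto simp: directed_bonds_def)
  next
    fix C C' assume "C \<in> directed_cycles G" "C' \<in> directed_cycles G" "supp C' \<subseteq> supp C"
    then show "supp C' = supp C"
      using simple_cycle_minimal[OF wf finite_arcs] by (auto simp: cycles)
  next
    fix D D' assume D: "D \<in> directed_bonds G" "D' \<in> directed_bonds G" "supp D' \<subseteq> supp D"
    have "supp D \<in> bonds G" "supp D' \<in> bonds G" using D(1,2) bond_supp by auto
    obtain S where "S \<subseteq> verts G" "D' = cut_vector G S" using D(2) unfolding directed_bonds_def by blast
    moreover have "supp D' \<noteq> {}" using \<open>supp D' \<in> bonds G\<close> by (simp add: bonds_def)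
    moreover have "\<forall>S\<subseteq>verts G. cut G S \<noteq> {} \<longrightarrow> cut G S \<subseteq> supp D \<longrightarrow> cut G S = supp D"
      using \<open>supp D \<in> bonds G\<close> by (simp add: bonds_def)
    ultimately show "supp D' = supp D" using D(3) by (simp add: supp_cut_vector)
  next
    fix C D assume "C \<in> directed_cycles G" "D \<in> directed_bonds G"
    then show "dot (arcs G) (real_vec C) (real_vec D) = 0"
      using cycle_cut_orthogonal[OF finite_arcs] by (auto simp: cycles directed_bonds_def)
  next
    fix e s and F :: "'b \<Rightarrow> int \<Rightarrow> bool"
    assume "e \<in> arcs G" "s \<in> {1, - 1}" "F e s" "\<not> F e (- s)"
    then show "(\<exists>C\<in>directed_cycles G. C e = s \<and> (\<forall>f\<in>supp C. F f (C f))) \<or>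
        (\<exists>D\<in>directed_bonds G. D e = s \<and> (\<forall>f\<in>supp D. \<not> F f (- D f)))"
      by (rule graph_painting[OF wf finite_arcs con])
  qed
qed

text \<open>
  A set of edges connects the graph iff it meets every nonempty cut, hence iff it meets every bond.
\<close>

lemma spanning_trees_bases:
  assumes "fin_digraph G" and con: "Digraph_Component.connected G"
  shows "spanning_trees G =
    Collect (regular_matroid.basis (arcs G) (directed_cycles G) (directed_bonds G))"
proof -
  interpret fin_digraph G by fact
  interpret M: regular_matroid "arcs G" "directed_cycles G" "directed_bonds G"
    by (rule graph_regular_matroid[OF assms])
  have "Digraph_Component.connected (G\<lparr>arcs := T\<rparr>) \<longleftrightarrow> (\<forall>D\<in>directed_bonds G. \<not> supp D \<subseteq> arcs G - T)"
    if T: "T \<subseteq> arcs G" for T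
  proof -
    have cut_T: "cut (G\<lparr>arcs := T\<rparr>) S = cut G S \<inter> T" for S using T by (auto simp: cut_def)
    have con_T: "Digraph_Component.connected (G\<lparr>arcs := T\<rparr>) \<longleftrightarrow>
        verts G \<noteq> {} \<and> (\<forall>S\<subseteq>verts G. cut G S \<inter> T = {} \<longrightarrow> S = {} \<or> S = verts G)"
      using connected_iff_cuts[OF wf_restrict_arcs[OF wf_digraph_axioms T]] by (simp add: cut_T)
    have con_G: "verts G \<noteq> {}" "\<And>S. S \<subseteq> verts G \<Longrightarrow> cut G S = {} \<Longrightarrow> S = {} \<or> S = verts G"
      using con connected_iff_cuts[OF wf_digraph_axioms] by auto
    have triv: "cut G {} = {}" "cut G (verts G) = {}" by (auto simp: cut_def)
    show ?thesis
    proof (intro iffI ballI notI)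
      fix D assume "Digraph_Component.connected (G\<lparr>arcs := T\<rparr>)" and D: "D \<in> directed_bonds G"
        "supp D \<subseteq> arcs G - T"
      then obtain S where S: "S \<subseteq> verts G" "D = cut_vector G S" by (auto simp: directed_bonds_def)
      then have "cut G S \<inter> T = {}" using D(2) by (auto simp: supp_cut_vector)
      then have "S = {} \<or> S = verts G"
        using S(1) con_T \<open>Digraph_Component.connected (G\<lparr>arcs := T\<rparr>)\<close> by blast
      then have "cut G S = {}" using triv by blast
      then show False using M.supp_nonempty[of D] D(1) S(2) by (simp add: supp_cut_vector)
    next
      assume bonds: "\<forall>D\<in>directed_bonds G. \<not> supp D \<subseteq> arcs G - T"
      have empty: "cut G S = {}" if S: "S \<subseteq> verts G" "cut G S \<inter> T = {}" for S
      proof (rule ccontr)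
        assume "cut G S \<noteq> {}"
        then obtain e where "e \<in> cut G S" by blast
        then obtain S' where S': "S' \<subseteq> verts G" "cut G S' \<in> bonds G" "cut_conforms G S' S"
          using bond_in_cut[OF wf_digraph_axioms finite_arcs con S(1)] by blast
        then have "cut_vector G S' \<in> directed_bonds G" by (auto simp: directed_bonds_def)
        moreover have "supp (cut_vector G S') \<subseteq> arcs G - T"
          using S'(3) S(2) by (auto simp: supp_cut_vector cut_conforms_def cut_def)
        ultimately show False using bonds by blast
      qed
      show "Digraph_Component.connected (G\<lparr>arcs := T\<rparr>)"
        unfolding con_T using con_G(1) con_G(2)[OF _ empty] by simp
    qed
  qed
  then show ?thesis
    by (auto simp: spanning_trees_def M.basis_def simple_cycles_def)
qed

section \<open>Spanning trees and cycle-cocycle classes\<close>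

theorem theorem1p1p2:
  fixes G :: "('a, 'b) pre_digraph"
    and \<sigma> \<sigma>' :: "'b set \<Rightarrow> 'b \<Rightarrow> int"
  assumes "fin_digraph G"
    and "Digraph_Component.connected G"
    and "acyclic_cycle_signature G \<sigma>"
    and "acyclic_cut_signature G \<sigma>'"
  shows "bij_betw (\<lambda>T. cycle_cocycle_equiv G `` {tree_orientation G \<sigma> \<sigma>' T})
           (spanning_trees G) (cycle_cocycle_classes G)"
proof -
  interpret M: regular_matroid "arcs G" "directed_cycles G" "directed_bonds G"
    by (rule graph_regular_matroid[OF assms(1,2)])
  obtain w where w: "positive_signature (arcs G) (directed_cycles G) \<sigma> w"
    using assms(3) M.supp_subset
    by (elim positive_signature_of_acyclic[OF M.finite_E, rotated -1])
      (auto simp: acyclic_cycle_signature_def cycle_signature_def simple_cycles_def)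
  obtain w' where w': "positive_signature (arcs G) (directed_bonds G) \<sigma>' w'"
    using assms(4) M.supp_subset
    by (elim positive_signature_of_acyclic[OF M.finite_E, rotated -1])
      (auto simp: acyclic_cut_signature_def cut_signature_def bonds_eq)
  let ?O = "tree_orientation G \<sigma> \<sigma>'" and ?R = "cycle_cocycle_equiv G"
  have trees: "spanning_trees G = Collect M.basis" by (rule spanning_trees_bases[OF assms(1,2)])
  have O_eq: "?O T = M.basis_orientation \<sigma> \<sigma>' T" for T
    by (auto simp: fun_eq_iff tree_orientation_def M.basis_orientation_def fund_cut_def
        fund_cycle_def fundamental_def simple_cycles_def bonds_eq)
  have orients_eq: "orientations G = orients (arcs G)"
    by (simp add: orientations_def orients_def)
  have rev_eq: "reversal G = flips (directed_cycles G \<union> directed_bonds G)"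
    by (intro ext) (simp add: reversal_def flips_def flip_def conforms_def)
  note bij = M.basis_orientations_represent_classes[OF w w', folded O_eq orients_eq rev_eq]
  have R_iff: "(X, Y) \<in> ?R \<longleftrightarrow> X \<in> orientations G \<and> Y \<in> orientations G \<and> equivclp (reversal G) X Y"
    for X Y by (simp add: cycle_cocycle_equiv_def)
  have equiv: "equiv (orientations G) ?R"
  proof (rule equivI)
    show "refl_on (orientations G) ?R" by (auto simp: refl_on_def R_iff)
    show "sym ?R" by (auto simp: sym_def R_iff intro: equivclp_sym)
    show "trans ?R" by (auto simp: trans_def R_iff intro: equivclp_trans)
  qed (auto simp: R_iff)
  show ?thesis
  proof (rule bij_betwI')
    fix T\<^sub>1 T\<^sub>2 assume T: "T\<^sub>1 \<in> spanning_trees G" "T\<^sub>2 \<in> spanning_trees G"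
    then have O: "?O T\<^sub>1 \<in> orientations G" "?O T\<^sub>2 \<in> orientations G" using bij(1) by (auto simp: trees)
    show "?R `` {?O T\<^sub>1} = ?R `` {?O T\<^sub>2} \<longleftrightarrow> T\<^sub>1 = T\<^sub>2"
      using eq_equiv_class_iff[OF equiv O] bij(2)[of T\<^sub>1 T\<^sub>2] T by (auto simp: R_iff trees)
  next
    fix T assume "T \<in> spanning_trees G"
    then show "?R `` {?O T} \<in> cycle_cocycle_classes G"
      using bij(1) by (auto simp: trees cycle_cocycle_classes_def intro: quotientI)
  next
    fix K assume "K \<in> cycle_cocycle_classes G"
    then obtain X where X: "X \<in> orientations G" "K = ?R `` {X}"
      by (auto simp: cycle_cocycle_classes_def elim: quotientE)
    then obtain T where T: "M.basis T" "equivclp (reversal G) X (?O T)" using bij(3) by blast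
    then have "(X, ?O T) \<in> ?R" using X(1) bij(1) by (simp add: R_iff)
    then have "K = ?R `` {?O T}" using X(2) equiv_class_eq[OF equiv] by blast
    then show "\<exists>T\<in>spanning_trees G. K = ?R `` {?O T}" using T(1) by (auto simp: trees)
  qed
qed

end
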